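(* Let $\mathcal P$ be a primitive integral octahedral packing such that either every curvature in $\mathcal P$ is congruent modulo $8$ to one of $0,1,2$, or every curvature in $\mathcal P$ is congruent modulo $8$ to one of $2,4,7$. For tangent circles $\mathcal C,\mathcal C'$ of $\mathcal P$ with curvatures $a\neq 0$ and $b$ satisfying $\gcd(a,b)=1$, put $\rho=a+b$ and $$\chi(\mathcal C,\mathcal C')=\begin{cases}\left(\frac{\rho}{a}\right) & a\not\equiv 2,4 \pmod 8,\\ \left(\frac{\rho}{a/2}\right) & a\equiv 2\pmod 8,\\ \left(\frac{-\rho}{a}\right) & a\equiv 4\pmod 8.\end{cases}$$ Suppose $\chi(\mathcal C,\mathcal C')=-1$ for every such pair. Then no circle of $\mathcal P$ has curvature of the form $n^2$ or $2n^2$ with $n$ an integer.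
   Context: Generalized circles are circles and lines in the extended plane; each circle of a packing has signed curvature: $0$ for a line, $1/r$ for a circle of radius $r$, and $-1/r$ for a circle containing all other circles of the packing. An octahedral configuration is a set of six generalized circles with pairwise disjoint interiors, any two tangent or disjoint, whose tangency graph is the octahedron graph. For each of the 8 triangular faces, the dual circle through the three tangency points is orthogonal to the three circles. The octahedral Apollonian group is generated by the inversions in the 8 dual circles, and the octahedral packing is the union of the orbit of the six circles under this group. The packing is integral if all curvatures are integers and primitive if their gcd is $1$. $\left(\frac{m}{n}\right)$ denotes the Kronecker symbol: the Legendre symbol for $n$ an odd prime; $\left(\frac{m}{2}\right)=0$ for $m$ even, $1$ for $m\equiv\pm1\pmod 8$, $-1$ for $m\equiv\pm3\pmod 8$; $\left(\frac{m}{-1}\right)=1$ if $m\ge0$ and $-1$ if $m<0$; $\left(\frac m1\right)=1$; extended multiplicatively in $n$. *)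

theory Defs
  imports
    "HOL-Analysis.Analysis"
    "HOL-Algebra.Bij"
    "HOL-Algebra.Generated_Groups"
    "HOL-Number_Theory.Number_Theory"
begin

text \<open>The extended plane is \<^typ>\<open>complex option\<close>, with \<^term>\<open>None\<close> as the point at infinity
  (as in \<open>Alexandroff_compactification\<close>).\<close>

type_synonym eplane = "complex option"

definition circle :: "complex \<Rightarrow> real \<Rightarrow> eplane set" where
  "circle c r = Some ` sphere c r"

definition line :: "complex \<Rightarrow> real \<Rightarrow> eplane set" where
  "line u d = insert None (Some ` {z. u \<bullet> z = d})"

definition generalized_circle :: "eplane set \<Rightarrow> bool" where
  "generalized_circle C \<longleftrightarrow> (\<exists>c r. r > 0 \<and> C = circle c r) \<or> (\<exists>u d. u \<noteq> 0 \<and> C = line u d)"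

text \<open>The two components of the complement of a generalized circle: the candidates for its
  interior. Both half-planes of a line arise, since \<^term>\<open>line u d = line (- u) (- d)\<close>.\<close>

inductive side_of :: "eplane set \<Rightarrow> eplane set \<Rightarrow> bool" where
  inside: "r > 0 \<Longrightarrow> side_of (circle c r) (Some ` ball c r)"
| outside: "r > 0 \<Longrightarrow> side_of (circle c r) (- (Some ` cball c r))"
| half_plane: "u \<noteq> 0 \<Longrightarrow> side_of (line u d) (Some ` {z. u \<bullet> z < d})"

text \<open>Distinct generalized circles are tangent iff they meet in exactly one point of the extended
  plane; in particular parallel lines are tangent at infinity, and crossing lines are not tangent.\<close>

definition tangent :: "eplane set \<Rightarrow> eplane set \<Rightarrow> bool" where
  "tangent C C' \<longleftrightarrow> (\<exists>p. C \<inter> C' = {p})"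

definition circle_inversion :: "complex \<Rightarrow> real \<Rightarrow> eplane \<Rightarrow> eplane" where
  "circle_inversion c r p = (case p of
      None \<Rightarrow> Some c
    | Some z \<Rightarrow> if z = c then None else Some (c + of_real (r\<^sup>2) / cnj (z - c)))"

definition line_reflection :: "complex \<Rightarrow> real \<Rightarrow> eplane \<Rightarrow> eplane" where
  "line_reflection u d p = (case p of
      None \<Rightarrow> None
    | Some z \<Rightarrow> Some (z - (2 * (u \<bullet> z - d) / (u \<bullet> u)) *\<^sub>R u))"

inductive inversion_in :: "eplane set \<Rightarrow> (eplane \<Rightarrow> eplane) \<Rightarrow> bool" where
  "r > 0 \<Longrightarrow> inversion_in (circle c r) (circle_inversion c r)"
| "u \<noteq> 0 \<Longrightarrow> inversion_in (line u d) (line_reflection u d)"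

text \<open>The octahedron graph is modelled on the vertices \<open>0, \<dots>, 5\<close>, where \<open>i\<close> and \<open>i + 3\<close> are
  antipodal and all other pairs of distinct vertices are adjacent.\<close>

definition octahedron_adj :: "nat \<Rightarrow> nat \<Rightarrow> bool" where
  "octahedron_adj i j \<longleftrightarrow> i mod 3 \<noteq> j mod 3"

definition octahedral_configuration :: "eplane set set \<Rightarrow> bool" where
  "octahedral_configuration S \<longleftrightarrow>
     card S = 6 \<and>
     (\<forall>C\<in>S. generalized_circle C) \<and>
     (\<exists>I. (\<forall>C\<in>S. side_of C (I C)) \<and> disjoint_family_on I S) \<and>
     pairwise (\<lambda>C C'. tangent C C' \<or> disjnt C C') S \<and>
     (\<exists>v. bij_betw v {..<6} S \<and>
          (\<forall>i<6. \<forall>j<6. tangent (v i) (v j) \<longleftrightarrow> octahedron_adj i j))"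

text \<open>The faces of the octahedron are exactly the triangles of its graph, that is, the triples of
  pairwise tangent circles.\<close>

definition dual_circles :: "eplane set set \<Rightarrow> eplane set set" where
  "dual_circles S =
     {D. generalized_circle D \<and>
         (\<exists>A\<in>S. \<exists>B\<in>S. \<exists>C\<in>S. tangent A B \<and> tangent B C \<and> tangent A C \<and>
            A \<inter> B \<subseteq> D \<and> B \<inter> C \<subseteq> D \<and> A \<inter> C \<subseteq> D)}"

definition octahedral_apollonian_group :: "eplane set set \<Rightarrow> (eplane \<Rightarrow> eplane) set" where
  "octahedral_apollonian_group S =
     generate (BijGroup UNIV) {f. \<exists>D\<in>dual_circles S. inversion_in D f}"

definition packing_of :: "eplane set set \<Rightarrow> eplane set set" where
  "packing_of S = {g ` C | g C. g \<in> octahedral_apollonian_group S \<and> C \<in> S}"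

definition octahedral_packing :: "eplane set set \<Rightarrow> bool" where
  "octahedral_packing P \<longleftrightarrow> (\<exists>S. octahedral_configuration S \<and> P = packing_of S)"

inductive has_curvature :: "eplane set set \<Rightarrow> eplane set \<Rightarrow> real \<Rightarrow> bool" for P where
  "u \<noteq> 0 \<Longrightarrow> has_curvature P (line u d) 0"
| "r > 0 \<Longrightarrow> \<exists>C'\<in>P - {circle c r}. \<not> C' \<subseteq> Some ` cball c r \<Longrightarrow>
     has_curvature P (circle c r) (1 / r)"
| "r > 0 \<Longrightarrow> \<forall>C'\<in>P - {circle c r}. C' \<subseteq> Some ` cball c r \<Longrightarrow>
     has_curvature P (circle c r) (- 1 / r)"

definition curvature :: "eplane set set \<Rightarrow> eplane set \<Rightarrow> real" where
  "curvature P C = (THE k. has_curvature P C k)"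

definition integral_packing :: "eplane set set \<Rightarrow> bool" where
  "integral_packing P \<longleftrightarrow> (\<forall>C\<in>P. curvature P C \<in> \<int>)"

definition int_curvatures :: "eplane set set \<Rightarrow> int set" where
  "int_curvatures P = {k. \<exists>C\<in>P. curvature P C = of_int k}"

definition primitive_packing :: "eplane set set \<Rightarrow> bool" where
  "primitive_packing P \<longleftrightarrow> Gcd (int_curvatures P) = 1"

definition kronecker_prime :: "int \<Rightarrow> int \<Rightarrow> int" where
  "kronecker_prime m p =
     (if p = 2 then if even m then 0 else if m mod 8 \<in> {1, 7} then 1 else - 1
      else Legendre m p)"

definition kronecker_unit :: "int \<Rightarrow> int \<Rightarrow> int" where
  "kronecker_unit m s = (if s = - 1 \<and> m < 0 then - 1 else 1)"

text \<open>Only used for \<^term>\<open>n \<noteq> 0\<close>; \<^const>\<open>prime_factors\<close> yields the positive prime divisors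
  of \<^term>\<open>n\<close>, whatever its sign.\<close>

definition kronecker :: "int \<Rightarrow> int \<Rightarrow> int" where
  "kronecker m n =
     kronecker_unit m (sgn n) *
     (\<Prod>p\<in>prime_factors n. kronecker_prime m p ^ multiplicity p n)"

text \<open>\<open>chi a b\<close> is the invariant of a pair of tangent circles with curvatures \<open>a\<close> and \<open>b\<close>.\<close>

definition chi :: "int \<Rightarrow> int \<Rightarrow> int" where
  "chi a b =
     (let \<rho> = a + b in
      if [a = 2] (mod 8) then kronecker \<rho> (a div 2)
      else if [a = 4] (mod 8) then kronecker (- \<rho>) a
      else kronecker \<rho> a)"

end

theory Submission
  imports Defs
begin

text \<open>Generalized circles are unit vectors of a Minkowski space of signature (3,1), points are null
  vectors, and inversions act as Lorentz reflections. The six circles of a configuration become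
  unit vectors \<open>v 0, \<dots>, v 5\<close> with \<open>v i + v (i + 3) = 2 w\<close> independent of \<open>i\<close>, and the unsigned
  curvature is the absolute value of a linear functional, which is enough since \<open>chi a b = 1\<close> for
  \<open>a = n\<^sup>2\<close> or \<open>a = 2 n\<^sup>2\<close> and \<open>b\<close> coprime to \<open>a\<close>, whatever the sign of \<open>b\<close>.
  It remains to find, for every circle, a tangent circle of coprime curvature. If \<open>a \<noteq> 0\<close>, one runs
  through the chain of circles tangent to two fixed tangent circles; their curvatures form a
  quadratic polynomial that can be made nonzero modulo all primes dividing \<open>a\<close> simultaneously.
  If \<open>a = 0\<close>, the configuration containing the line for which \<open>w\<close> has the smallest curvature contains a
  neighbour of curvature 1.\<close>

section \<open>Circles, points and inversions in Minkowski space\<close>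

text \<open>For a face, the three vectors \<open>v i - w\<close> and \<open>w\<close> are pairwise
  orthogonal of norms 2, 2, 2 and -1. The vector \<open>w - v i - v j - v k\<close> of the dual
  circle has norm 2, so its reflection involves no square root and maps the six vectors to integral
  combinations of themselves. This transports primitivity from the whole packing to each single
  configuration. Two obstacles shape the search for neighbours. All curvatures in a chain agree
  modulo 4, so for even \<open>a\<close> the chain has to start at a neighbour of odd curvature. For
  \<open>a = 0\<close> coprimality means curvature 1 or -1, which no congruence argument produces;
  hence the descent. There the sign does matter, since \<open>chi (-1) 0 = -1\<close>: the line
  itself, passing through infinity, is what excludes curvature -1.\<close>

type_synonym minkowski = "real \<times> complex \<times> real"

text \<open>The vector \<open>(A, B, D)\<close> encodes the generalized circle \<open>A |z|\<^sup>2 - 2 (B \<bullet> z) + D = 0\<close>; for a unit vector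
  \<open>|A|\<close> is the unsigned curvature, and \<open>v\<close>, \<open>- v\<close> correspond to the two choices of an interior.\<close>

definition mink :: "minkowski \<Rightarrow> minkowski \<Rightarrow> real" where
  "mink x y = fst (snd x) \<bullet> fst (snd y) - (fst x * snd (snd y) + snd (snd x) * fst y) / 2"

definition pt :: "eplane \<Rightarrow> minkowski" where
  "pt p = (case p of None \<Rightarrow> (0, 0, 1) | Some z \<Rightarrow> (1, z, (cmod z)\<^sup>2))"

definition locus :: "minkowski \<Rightarrow> eplane set" where
  "locus v = {p. mink v (pt p) = 0}"

definition mrefl :: "minkowski \<Rightarrow> minkowski \<Rightarrow> minkowski" where
  "mrefl d x = x - (2 * mink d x) *\<^sub>R d"

lemma pt_simps [simp]: "pt None = (0, 0, 1)" "pt (Some z) = (1, z, (cmod z)\<^sup>2)"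
  by (simp_all add: pt_def)

lemma mink_commute: "mink x y = mink y x"
  by (simp add: mink_def inner_commute algebra_simps)

lemma mink_add_left: "mink (x + y) z = mink x z + mink y z"
  by (simp add: mink_def inner_add_left inner_add_right algebra_simps add_divide_distrib)

lemma mink_diff_left: "mink (x - y) z = mink x z - mink y z"
  by (simp add: mink_def inner_diff_left inner_diff_right algebra_simps diff_divide_distrib add_divide_distrib)

lemma mink_scale_left: "mink (r *\<^sub>R x) z = r * mink x z"
  by (simp add: mink_def algebra_simps)

lemma mink_add_right: "mink z (x + y) = mink z x + mink z y"
  by (metis mink_add_left mink_commute)

lemma mink_diff_right: "mink z (x - y) = mink z x - mink z y"
  by (metis mink_diff_left mink_commute)

lemma mink_scale_right: "mink z (r *\<^sub>R x) = r * mink z x"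
  by (metis mink_scale_left mink_commute)

lemma mink_minus_left: "mink (- x) z = - mink x z"
  using mink_scale_left[of "-1"] by simp

lemma mink_minus_right: "mink z (- x) = - mink z x"
  by (metis mink_minus_left mink_commute)

lemma mink_zero [simp]: "mink 0 x = 0" "mink x 0 = 0"
  by (simp_all add: mink_def)

lemmas mink_lin = mink_add_left mink_add_right mink_diff_left mink_diff_right
  mink_scale_left mink_scale_right mink_minus_left mink_minus_right

lemma locus_minus [simp]: "locus (- v) = locus v"
  by (simp add: locus_def mink_lin)

lemma locus_scale: "r \<noteq> 0 \<Longrightarrow> locus (r *\<^sub>R v) = locus v"
  by (simp add: locus_def mink_lin)

lemma mink_mrefl_left: "mink (mrefl d x) y = mink x (mrefl d y)"
  by (simp add: mrefl_def mink_lin mink_commute algebra_simps)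

lemma mink_nondegenerate:
  assumes "\<And>y. mink x y = 0" shows "x = 0"
proof -
  have "mink x (1, 0, 0) = 0" "mink x (0, 0, 1) = 0" "mink x (0, fst (snd x), 0) = 0"
    using assms by blast+
  then show ?thesis by (simp add: mink_def prod_eq_iff)
qed

definition cvec :: "complex \<Rightarrow> real \<Rightarrow> minkowski" where
  "cvec c r = (1 / r, c /\<^sub>R r, ((cmod c)\<^sup>2 - r\<^sup>2) / r)"

definition lvec :: "complex \<Rightarrow> real \<Rightarrow> minkowski" where
  "lvec u d = (0, u /\<^sub>R cmod u, 2 * d / cmod u)"

lemma mink_cvec_self: "r \<noteq> 0 \<Longrightarrow> mink (cvec c r) (cvec c r) = 1"
  by (simp add: mink_def cvec_def field_simps flip: power2_norm_eq_inner) (simp add: power2_eq_square power4_eq_xxxx)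

lemma mink_lvec_self: "u \<noteq> 0 \<Longrightarrow> mink (lvec u d) (lvec u d) = 1"
  by (simp add: mink_def lvec_def field_simps flip: power2_norm_eq_inner)

lemma mink_cvec_Some: "r \<noteq> 0 \<Longrightarrow> mink (cvec c r) (pt (Some z)) = (r\<^sup>2 - (dist c z)\<^sup>2) / (2 * r)"
  by (simp add: mink_def cvec_def dist_norm power2_norm_eq_inner inner_diff_left inner_diff_right
      inner_commute field_simps)

lemma mink_cvec_None: "mink (cvec c r) (pt None) = - 1 / (2 * r)"
  by (simp add: mink_def cvec_def)

lemma mink_lvec_Some: "u \<noteq> 0 \<Longrightarrow> mink (lvec u d) (pt (Some z)) = (u \<bullet> z - d) / cmod u"
  by (simp add: mink_def lvec_def field_simps)

lemma mink_lvec_None: "mink (lvec u d) (pt None) = 0"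
  by (simp add: mink_def lvec_def)

lemma locus_cvec:
  assumes "r > 0" shows "locus (cvec c r) = circle c r"
proof (intro Set.set_eqI)
  fix p show "p \<in> locus (cvec c r) \<longleftrightarrow> p \<in> circle c r"
    using assms
    by (cases p) (auto simp: locus_def circle_def mink_cvec_Some mink_cvec_None image_iff
        simp del: pt_simps)
qed

lemma locus_lvec:
  assumes "u \<noteq> 0" shows "locus (lvec u d) = line u d"
proof (intro Set.set_eqI)
  fix p show "p \<in> locus (lvec u d) \<longleftrightarrow> p \<in> line u d"
    using assms
    by (cases p) (auto simp: locus_def line_def mink_lvec_Some mink_lvec_None image_iff
        simp del: pt_simps)
qed

definition pos :: "minkowski \<Rightarrow> eplane set" where
  "pos v = {p. mink v (pt p) > 0}"

lemma pos_cvec: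
  assumes "r > 0" shows "pos (cvec c r) = Some ` ball c r"
    and "pos (- cvec c r) = - (Some ` cball c r)"
proof -
  have *: "(dist c z)\<^sup>2 < r\<^sup>2 \<longleftrightarrow> dist c z < r" "r\<^sup>2 < (dist c z)\<^sup>2 \<longleftrightarrow> r < dist c z" for z
    using assms by (smt (verit) power_strict_mono zero_le_dist zero_less_numeral power_mono)+
  show "pos (cvec c r) = Some ` ball c r"
  proof (intro Set.set_eqI)
    fix p show "p \<in> pos (cvec c r) \<longleftrightarrow> p \<in> Some ` ball c r"
      using assms
      by (cases p) (auto simp: pos_def mink_cvec_Some mink_cvec_None image_iff * zero_less_divide_iff
          simp del: pt_simps)
  qed
  show "pos (- cvec c r) = - (Some ` cball c r)"
  proof (intro Set.set_eqI)
    fix p show "p \<in> pos (- cvec c r) \<longleftrightarrow> p \<in> - (Some ` cball c r)"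
      using assms
      by (cases p) (auto simp: pos_def mink_cvec_Some mink_cvec_None image_iff * divide_less_0_iff
          mink_lin simp del: pt_simps)
  qed
qed

lemma pos_lvec:
  assumes "u \<noteq> 0" shows "pos (- lvec u d) = Some ` {z. u \<bullet> z < d}"
proof (intro Set.set_eqI)
  fix p show "p \<in> pos (- lvec u d) \<longleftrightarrow> p \<in> Some ` {z. u \<bullet> z < d}"
    using assms
    by (cases p) (auto simp: pos_def mink_lvec_Some mink_lvec_None image_iff divide_less_0_iff
        mink_lin simp del: pt_simps)
qed

text \<open>The signs are forced: \<open>cvec c r\<close> is positive inside the circle and
  \<open>lvec u d\<close> where \<open>u \<bullet> z > d\<close>, so the exterior and the half-plane
  need the negated vector. Nonemptiness is recorded because disjointness of two interiors excludes
  nesting only if they are nonempty.\<close>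

lemma side_of_vec:
  assumes "side_of C I"
  shows "\<exists>v. mink v v = 1 \<and> C = locus v \<and> I = pos v \<and> I \<noteq> {}"
  using assms
proof cases
  case (inside r c)
  then show ?thesis
    by (intro exI[of _ "cvec c r"]) (auto simp: mink_cvec_self locus_cvec pos_cvec)
next
  case (outside r c)
  have "None \<in> - (Some ` cball c r)" by auto
  then show ?thesis using outside
    by (intro exI[of _ "- cvec c r"]) (auto simp: mink_cvec_self locus_cvec pos_cvec mink_lin)
next
  case (half_plane u d)
  have "u \<bullet> (((d - 1) / (u \<bullet> u)) *\<^sub>R u) < d" using half_plane by simp
  then have "Some ` {z. u \<bullet> z < d} \<noteq> {}" by blast
  then show ?thesis using half_plane
    by (intro exI[of _ "- lvec u d"]) (auto simp: mink_lvec_self locus_lvec pos_lvec mink_lin)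
qed

lemma unit_vec_cases:
  assumes "mink v v = 1"
  obtains (circ) c r where "r > 0" "\<bar>fst v\<bar> = 1 / r" "locus v = circle c r"
  | (lin) u d where "u \<noteq> 0" "fst v = 0" "locus v = line u d"
proof -
  obtain A B D where v: "v = (A, B, D)" by (cases v)
  have n: "B \<bullet> B - A * D = 1" using assms by (simp add: v mink_def)
  show ?thesis
  proof (cases "A = 0")
    case True
    then have "cmod B ^ 2 = 1" using n by (simp add: power2_norm_eq_inner)
    then have B: "cmod B = 1" using power2_eq_1_iff[of "cmod B"] by (smt (verit) norm_ge_zero)
    then have "v = lvec B (D / 2)" by (simp add: v lvec_def True)
    moreover have "B \<noteq> 0" using B by auto
    ultimately show ?thesis using lin locus_lvec True v by (metis fst_conv)
  next
    case False
    have *: "(cmod (B /\<^sub>R A))\<^sup>2 - (1 / \<bar>A\<bar>)\<^sup>2 = D / A"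
      using n False by (simp add: power_divide power_mult_distrib field_simps flip: power2_norm_eq_inner) (simp add: algebra_simps power2_eq_square)
    have "v = sgn A *\<^sub>R cvec (B /\<^sub>R A) (1 / \<bar>A\<bar>)"
      using False unfolding cvec_def * by (simp add: v sgn_real_def)
    then have "locus v = circle (B /\<^sub>R A) (1 / \<bar>A\<bar>)"
      using False by (simp add: locus_scale locus_cvec sgn_zero_iff)
    then show ?thesis using circ[of "1/\<bar>A\<bar>"] False by (simp add: v)
  qed
qed

lemma generalized_circle_locus: "mink v v = 1 \<Longrightarrow> generalized_circle (locus v)"
  unfolding generalized_circle_def by (metis unit_vec_cases)

lemma null_vec:
  assumes "mink m m = 0" "m \<noteq> 0"
  obtains p l where "l \<noteq> 0" "m = l *\<^sub>R pt p"
proof -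
  obtain A B D where m: "m = (A, B, D)" by (cases m)
  have n: "(cmod B)\<^sup>2 = A * D" using assms by (simp add: m mink_def power2_norm_eq_inner)
  show ?thesis
  proof (cases "A = 0")
    case True
    then have "B = 0" "D \<noteq> 0" using n assms m by (auto simp: prod_eq_iff)
    then show ?thesis using that[of D None] True by (simp add: m)
  next
    case False
    then have "m = A *\<^sub>R pt (Some (B /\<^sub>R A))"
      using n by (simp add: m power_mult_distrib field_simps power2_eq_square)
    then show ?thesis using that False by blast
  qed
qed

text \<open>For finite points the product is minus half the squared distance: the vectors
  \<open>pt p\<close> lie on one nappe of the light cone, where orthogonality means
  equality.\<close>

lemma mink_pt_pt: "mink (pt p) (pt q) \<le> 0" "mink (pt p) (pt q) = 0 \<longleftrightarrow> p = q"
proof -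
  have *: "mink (pt (Some z)) (pt (Some w)) = - (dist z w)\<^sup>2 / 2" for z w
    by (simp add: mink_def dist_norm power2_norm_eq_inner inner_diff_left inner_diff_right
        inner_commute field_simps)
  show "mink (pt p) (pt q) \<le> 0" "mink (pt p) (pt q) = 0 \<longleftrightarrow> p = q"
    by (cases p; cases q; simp add: * del: pt_simps; simp add: mink_def)+
qed

section \<open>Tangency as a condition on the inner product\<close>

lemma locus_Int_tangent:
  assumes "mink u u = 1" "mink v v = 1" "mink u v = - 1" "u + v = l *\<^sub>R pt p" "l \<noteq> 0"
  shows "locus u \<inter> locus v = {p}"
proof (intro Set.set_eqI iffI)
  have "mink u (u + v) = 0" "mink v (u + v) = 0" using assms(1-3) by (simp_all add: mink_lin mink_commute)
  then have "mink u (pt p) = 0" "mink v (pt p) = 0" using assms(4,5) by (simp_all add: mink_lin)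
  then show "q \<in> {p} \<Longrightarrow> q \<in> locus u \<inter> locus v" for q by (simp add: locus_def)
  fix q assume "q \<in> locus u \<inter> locus v"
  then have "mink (u + v) (pt q) = 0" by (simp add: locus_def mink_lin)
  then show "q \<in> {p}" using assms(4,5) by (simp add: mink_lin mink_pt_pt)
qed

text \<open>A change of sign makes the product -1. The sum is then null, and nonzero because the
  loci differ, so it represents a point: the tangency point.\<close>

lemma tangent_locusI:
  assumes "mink u u = 1" "mink v v = 1" "\<bar>mink u v\<bar> = 1" "locus u \<noteq> locus v"
  shows "tangent (locus u) (locus v)"
proof -
  obtain v' where v': "mink v' v' = 1" "mink u v' = - 1" "locus v' = locus v"
    using assms(2,3) that[of v] that[of "- v"] by (auto simp: mink_lin abs_if split: if_splits)
  then have "mink (u + v') (u + v') = 0" "u + v' \<noteq> 0"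
    using assms(1,4) by (simp add: mink_lin mink_commute[of v' u], metis locus_minus add_eq_0_iff)
  then obtain l p where "l \<noteq> 0" "u + v' = l *\<^sub>R pt p" by (metis null_vec)
  then show ?thesis using locus_Int_tangent assms v' unfolding tangent_def by metis
qed

lemma unit_solve:
  fixes B B' :: complex
  assumes "B \<bullet> B = 1" "B' \<bullet> B' = 1" "\<bar>B \<bullet> B'\<bar> \<noteq> 1"
  obtains x where "B \<bullet> x = s" "B' \<bullet> x = t"
proof -
  define e where "e = Re B * Im B' - Im B * Re B'"
  have "e\<^sup>2 = (B \<bullet> B) * (B' \<bullet> B') - (B \<bullet> B')\<^sup>2"
    by (simp add: e_def inner_complex_def power2_eq_square algebra_simps)
  then have "e \<noteq> 0" using assms by (auto simp: power2_eq_1_iff abs_if split: if_splits)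
  then have "B \<bullet> Complex ((s * Im B' - t * Im B) / e) ((t * Re B - s * Re B') / e) = s"
    "B' \<bullet> Complex ((s * Im B' - t * Im B) / e) ((t * Re B - s * Re B') / e) = t"
    by (simp_all add: inner_complex_def divide_simps) (simp_all add: e_def algebra_simps)
  then show ?thesis using that by blast
qed

text \<open>Sending the common point to infinity turns both circles into lines. If the product is
  neither 1 nor -1, these lines are not parallel and meet in a finite point, which gives a second
  intersection.\<close>

lemma tangent_locusD:
  assumes u: "mink u u = 1" and v: "mink v v = 1" and tan: "tangent (locus u) (locus v)"
  shows "\<bar>mink u v\<bar> = 1"
proof (rule ccontr)
  assume y: "\<bar>mink u v\<bar> \<noteq> 1"
  obtain A B D where u': "u = (A, B, D)" by (cases u)
  obtain A' B' D' where v': "v = (A', B', D')" by (cases v)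
  obtain p where p: "locus u \<inter> locus v = {p}" using tan by (auto simp: tangent_def)
  have uniq: "q = p" if "mink u (pt q) = 0" "mink v (pt q) = 0" for q
    using that p unfolding locus_def by blast
  have pu: "mink u (pt p) = 0" and pv: "mink v (pt p) = 0"
    using p unfolding locus_def by blast+
  show False
  proof (cases p)
    case None
    then have A: "A = 0" "A' = 0" using pu pv by (simp_all add: u' v' mink_def)
    then have "B \<bullet> B = 1" "B' \<bullet> B' = 1" "\<bar>B \<bullet> B'\<bar> \<noteq> 1"
      using u v y unfolding u' v' by (simp_all add: mink_def)
    then obtain x where "B \<bullet> x = D / 2" "B' \<bullet> x = D' / 2"
      by (rule unit_solve)
    then have "Some x = p" by (intro uniq) (simp_all add: u' v' A mink_def)
    then show False using None by simp
  next
    case (Some c)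
    \<comment> \<open>With \<open>c\<close> as the origin both equations lose their constant term;
      \<open>b\<close> and \<open>b'\<close> are the unit normals at the common point.\<close>
    define b b' where "b = B - A *\<^sub>R c" and "b' = B' - A' *\<^sub>R c"
    have D: "D = 2 * (B \<bullet> c) - A * (c \<bullet> c)" "D' = 2 * (B' \<bullet> c) - A' * (c \<bullet> c)"
      using pu pv Some by (simp_all add: u' v' mink_def power2_norm_eq_inner)
    have bb: "b \<bullet> b = 1" "b' \<bullet> b' = 1" "b \<bullet> b' = mink u v"
      using u v unfolding u' v' mink_def
      by (simp_all add: b_def b'_def D inner_diff_left inner_diff_right
          inner_commute[of c B] inner_commute[of c B'])
        (simp_all add: field_simps)
    \<comment> \<open>Inversion about \<open>c\<close>: for
      \<open>w = (2 / (x \<bullet> x)) *\<^sub>R x\<close> the equation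
      \<open>b \<bullet> w = A * (w \<bullet> w) / 2\<close> becomes the linear equation
      \<open>b \<bullet> x = A\<close>. The solution \<open>x = 0\<close> means two lines, whose
      second common point is infinity.\<close>
    obtain x where x: "b \<bullet> x = A" "b' \<bullet> x = A'" using unit_solve[of b b'] y bb by metis
    have m: "mink u (pt (Some (c + w))) = b \<bullet> w - A * (w \<bullet> w) / 2"
      "mink v (pt (Some (c + w))) = b' \<bullet> w - A' * (w \<bullet> w) / 2" for w
      by (simp_all add: b_def b'_def u' v' mink_def D inner_diff_left inner_add_left
          inner_add_right power2_norm_eq_inner inner_commute[of w c] field_simps)
    show False
    proof (cases "x = 0")
      case True
      then have "None = p" using x by (intro uniq) (simp_all add: u' v' mink_def)
      then show False using Some by simp
    next
      case False
      then have "Some (c + (2 / (x \<bullet> x)) *\<^sub>R x) = p"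
        by (intro uniq) (simp_all add: m x del: pt_simps)
      then show False using Some False by simp
    qed
  qed
qed

text \<open>If the product were 1, \<open>u - v\<close> would be zero or a multiple of a point
  vector. Products of point vectors have one sign, so one interior would contain the other.\<close>

lemma tangent_disjoint_pos:
  assumes u: "mink u u = 1" and v: "mink v v = 1" and tan: "tangent (locus u) (locus v)"
    and dis: "pos u \<inter> pos v = {}" and ne: "pos u \<noteq> {}" "pos v \<noteq> {}"
  shows "mink u v = - 1"
proof (rule ccontr)
  assume "mink u v \<noteq> - 1"
  then have y: "mink u v = 1" using tangent_locusD[OF u v tan] by auto
  show False
  proof (cases "u = v")
    case True
    then show False using dis ne by auto
  next
    case False
    then have "mink (u - v) (u - v) = 0" "u - v \<noteq> 0"
      using u v y by (simp_all add: mink_lin mink_commute)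
    then obtain l p where lp: "l \<noteq> 0" "u - v = l *\<^sub>R pt p" by (metis null_vec)
    have "mink u (pt q) - mink v (pt q) = l * mink (pt p) (pt q)" for q
      using arg_cong[OF lp(2), of "\<lambda>x. mink x (pt q)"] by (simp add: mink_lin)
    then have d: "mink u (pt q) - mink v (pt q) \<le> 0 \<or> l < 0" "mink u (pt q) - mink v (pt q) \<ge> 0 \<or> l > 0" for q
      using mink_pt_pt(1)[of p q] by (auto simp: mult_le_0_iff zero_le_mult_iff)
    show False
    proof (cases "l > 0")
      case True
      obtain q where "mink u (pt q) > 0" using ne by (auto simp: pos_def)
      then show False using d(1)[of q] True dis by (auto simp: pos_def disjoint_iff)
    next
      case False
      obtain q where "mink v (pt q) > 0" using ne by (auto simp: pos_def)
      then have "q \<in> pos u \<inter> pos v" using d(2)[of q] False by (simp add: pos_def)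
      then show False using dis by blast
    qed
  qed
qed

section \<open>Inversions as Lorentz reflections\<close>

lemma mrefl_cvec:
  assumes r: "r > 0" and w: "w \<noteq> 0"
  shows "mrefl (cvec c r) (pt (Some (c + w))) = ((w \<bullet> w) / r\<^sup>2) *\<^sub>R pt (Some (c + (r\<^sup>2 / (w \<bullet> w)) *\<^sub>R w))"
proof -
  define s where "s = w \<bullet> w"
  have s: "s > 0" using w by (simp add: s_def)
  have d: "(dist c (c + w))\<^sup>2 = s" by (simp add: s_def dist_norm power2_norm_eq_inner)
  have m: "2 * mink (cvec c r) (pt (Some (c + w))) = (r\<^sup>2 - s) / r"
    using r by (simp add: mink_cvec_Some d field_simps del: pt_simps)
  have 1: "1 - (r\<^sup>2 - s) / r * (1 / r) = s / r\<^sup>2"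
    using r by (simp add: field_simps power2_eq_square)
  have 2: "(c + w) - ((r\<^sup>2 - s) / r) *\<^sub>R (c /\<^sub>R r) = (s / r\<^sup>2) *\<^sub>R (c + (r\<^sup>2 / s) *\<^sub>R w)"
    using r s by (simp add: complex_eq_iff field_simps power2_eq_square)
  have 3: "(cmod (c + w))\<^sup>2 - (r\<^sup>2 - s) / r * (((cmod c)\<^sup>2 - r\<^sup>2) / r)
      = s / r\<^sup>2 * (cmod (c + (r\<^sup>2 / s) *\<^sub>R w))\<^sup>2"
  proof -
    have e: "(cmod (c + t *\<^sub>R w))\<^sup>2 = c \<bullet> c + 2 * t * (c \<bullet> w) + t\<^sup>2 * s" for t
      unfolding power2_norm_eq_inner
      by (simp add: s_def inner_add_left inner_add_right inner_commute[of w c] power2_eq_square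
          distrib_left)
    show ?thesis unfolding e[of "r\<^sup>2/s"] e[of 1, unfolded scaleR_one]
      unfolding power2_norm_eq_inner
      using r s by (simp add: field_simps power2_eq_square)
  qed
  show ?thesis unfolding mrefl_def m using 1 2 3 by (simp add: cvec_def flip: s_def)
qed

lemma mrefl_lvec:
  assumes "u \<noteq> 0"
  shows "mrefl (lvec u d) (pt (Some z)) = pt (Some (z - (2 * (u \<bullet> z - d) / (u \<bullet> u)) *\<^sub>R u))"
proof -
  define s where "s = cmod u"
  define t where "t = (u \<bullet> z - d) / s\<^sup>2"
  have s: "s > 0" using assms by (simp add: s_def)
  have uu: "u \<bullet> u = s\<^sup>2" by (simp add: s_def power2_norm_eq_inner)
  have uz: "u \<bullet> z = d + t * s\<^sup>2" using s by (simp add: t_def)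
  have m: "2 * mink (lvec u d) (pt (Some z)) = 2 * t * s"
    using assms s by (simp add: mink_lvec_Some uz power2_eq_square flip: s_def del: pt_simps)
  have "(cmod z)\<^sup>2 - 4 * t * d = (cmod (z - (2 * t) *\<^sub>R u))\<^sup>2"
    unfolding power2_norm_eq_inner
    by (simp add: inner_diff_left inner_diff_right inner_commute[of z u] uz uu,
       simp add: algebra_simps power2_eq_square)
  moreover have "2 * (u \<bullet> z - d) / (u \<bullet> u) = 2 * t" by (simp add: t_def uu)
  ultimately show ?thesis
    unfolding mrefl_def m using s by (simp add: lvec_def flip: s_def)
qed

text \<open>The action is projective: the factor \<open>l\<close> depends on the point and is
  harmless, since a locus is unaffected by scaling point vectors.\<close>

lemma inversion_in_vec:
  assumes "inversion_in D f"
  obtains d where "mink d d = 1" "D = locus d" "\<And>p. f (f p) = p"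
    "\<And>p. \<exists>l. l \<noteq> 0 \<and> mrefl d (pt p) = l *\<^sub>R pt (f p)"
  using assms
proof cases
  case (1 r c)
  have f: "circle_inversion c r (Some (c + w)) = Some (c + (r\<^sup>2 / (w \<bullet> w)) *\<^sub>R w)" if "w \<noteq> 0" for w
  proof -
    have "complex_of_real (w \<bullet> w) = w * cnj w"
      by (simp add: complex_eq_iff inner_complex_def)
    then have "of_real (r\<^sup>2) / cnj w = (r\<^sup>2 / (w \<bullet> w)) *\<^sub>R w"
      using that by (simp add: scaleR_conv_of_real)
    then show ?thesis using that by (simp add: circle_inversion_def)
  qed
  have "\<exists>l. l \<noteq> 0 \<and> mrefl (cvec c r) (pt p) = l *\<^sub>R pt (f p)" for p
  proof (cases p)
    case None
    have "(cmod c)\<^sup>2 / r\<^sup>2 = 1 + ((cmod c)\<^sup>2 - r\<^sup>2) / r / r"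
      using 1 by (simp add: field_simps power2_eq_square)
    then show ?thesis
      using 1 None by (intro exI[of _ "1 / r\<^sup>2"])
        (simp add: mrefl_def mink_cvec_None del: pt_simps(1),
         simp add: cvec_def circle_inversion_def complex_eq_iff, simp add: power2_eq_square inverse_eq_divide)
  next
    case (Some z)
    show ?thesis
    proof (cases "z = c")
      case True
      then show ?thesis
        using 1 Some by (intro exI[of _ "r\<^sup>2"])
          (simp add: mrefl_def mink_cvec_Some del: pt_simps(2),
           simp add: cvec_def circle_inversion_def complex_eq_iff, simp add: field_simps power2_eq_square)
    next
      case False
      then have "mrefl (cvec c r) (pt p) = (((z - c) \<bullet> (z - c)) / r\<^sup>2) *\<^sub>R pt (f p)"
        using mrefl_cvec[of r "z - c" c] f[of "z - c"] 1 Some by simp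
      then show ?thesis using False 1 by (intro exI[of _ "((z - c) \<bullet> (z - c)) / r\<^sup>2"]) auto
    qed
  qed
  moreover have "f (f p) = p" for p
    using 1 by (cases p) (auto simp: circle_inversion_def)
  ultimately show ?thesis using 1
    by (intro that[of "cvec c r"]) (simp_all add: mink_cvec_self locus_cvec)
next
  case (2 u d)
  have *: "mrefl (lvec u d) (pt p) = 1 *\<^sub>R pt (f p)" for p
  proof (cases p)
    case None
    then show ?thesis using 2
      by (simp add: mrefl_def mink_lvec_None line_reflection_def del: pt_simps)
  next
    case (Some z)
    then show ?thesis using 2 mrefl_lvec[of u d z] by (simp add: line_reflection_def del: pt_simps)
  qed
  have "f (f p) = p" for p
  proof (cases p)
    case (Some z)
    define t where "t = 2 * (u \<bullet> z - d) / (u \<bullet> u)"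
    have "2 * (u \<bullet> (z - t *\<^sub>R u) - d) / (u \<bullet> u) = - t"
      using 2 by (simp add: inner_diff_right field_simps t_def)
    then have "f (Some (z - t *\<^sub>R u)) = Some z"
      unfolding 2(2) line_reflection_def option.case by simp
    moreover have "f p = Some (z - t *\<^sub>R u)"
      unfolding 2(2) line_reflection_def t_def Some by simp
    ultimately show ?thesis using Some by simp
  qed (simp add: 2 line_reflection_def)
  moreover have "\<exists>l. l \<noteq> 0 \<and> mrefl (lvec u d) (pt p) = l *\<^sub>R pt (f p)" for p
    using *[of p] by (intro exI[of _ 1] conjI zero_neq_one[symmetric])
  ultimately show ?thesis using 2
    by (intro that[of "lvec u d"]) (simp_all add: mink_lvec_self locus_lvec)
qed

section \<open>Octahedral configurations\<close>

text \<open>Orthogonal non-null vectors are independent, so four of them span the 4-dimensional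
  space and \<open>u\<close> is orthogonal to everything. Equalities of vectors are proved below by
  pairing the difference with such a frame.\<close>

lemma mink_orthogonal_basis:
  assumes nz: "mink a a \<noteq> 0" "mink b b \<noteq> 0" "mink c c \<noteq> 0" "mink d d \<noteq> 0"
    and orth: "mink a b = 0" "mink a c = 0" "mink a d = 0" "mink b c = 0" "mink b d = 0" "mink c d = 0"
    and u: "mink u a = 0" "mink u b = 0" "mink u c = 0" "mink u d = 0"
  shows "u = 0"
proof (rule mink_nondegenerate)
  let ?B = "{a, b, c, d}"
  have orth': "mink x y = 0" if "x \<in> ?B" "y \<in> ?B" "x \<noteq> y" for x y
    using that orth by (auto simp: mink_commute)
  have nz': "mink x x \<noteq> 0" if "x \<in> ?B" for x using that nz by auto
  have "independent ?B"
  proof (rule independent_if_scalars_zero)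
    fix f x assume s: "(\<Sum>y\<in>?B. f y *\<^sub>R y) = 0" and x: "x \<in> ?B"
    have "linear (\<lambda>y. mink y x)" by (rule linearI) (simp_all add: mink_lin)
    then have "(\<Sum>y\<in>?B. f y * mink y x) = mink (\<Sum>y\<in>?B. f y *\<^sub>R y) x"
      by (subst linear_sum[of "\<lambda>y. mink y x"]) (simp_all only: mink_scale_left)
    also have "\<dots> = 0" unfolding s by simp
    also have "(\<Sum>y\<in>?B. f y * mink y x) = (\<Sum>y\<in>?B. if y = x then f x * mink x x else 0)"
      using orth' x by (intro sum.cong) auto
    finally show "f x = 0" using x nz' by (simp add: sum.delta)
  qed simp
  moreover have "card ?B = 4"
    using nz orth by (subst card_insert_disjoint; (auto)?)+
  ultimately have "span ?B = UNIV"
    using card_ge_dim_independent[of ?B UNIV] by auto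
  moreover have "mink u y = 0" if "y \<in> span ?B" for y
    using that by (induction rule: span_induct_alt) (use u in \<open>auto simp: mink_lin\<close>)
  ultimately show "mink u y = 0" for y by auto
qed

text \<open>The sums \<open>a + a'\<close>, \<open>b + b'\<close>, \<open>c + c'\<close> are orthogonal to the pairwise orthogonal differences
  \<open>a - a'\<close>, \<open>b - b'\<close>, \<open>c - c'\<close>, so they are proportional.\<close>

lemma opposite_sum_eq:
  assumes unit: "mink a a = 1" "mink a' a' = 1" "mink b b = 1" "mink b' b' = 1" "mink c c = 1" "mink c' c' = 1"
    and ab: "mink a b = -1" "mink a b' = -1" "mink a' b = -1" "mink a' b' = -1"
    and ac: "mink a c = -1" "mink a c' = -1" "mink a' c = -1" "mink a' c' = -1"
    and bc: "mink b c = -1" "mink b c' = -1" "mink b' c = -1" "mink b' c' = -1"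
    and opp: "\<bar>mink a a'\<bar> \<noteq> 1" "\<bar>mink b b'\<bar> \<noteq> 1" "\<bar>mink c c'\<bar> \<noteq> 1"
  shows "a + a' = b + b'"
proof -
  note sym = mink_commute[of a' a] mink_commute[of b' b] mink_commute[of c' c]
    mink_commute[of b a] mink_commute[of b' a] mink_commute[of b a'] mink_commute[of b' a']
    mink_commute[of c a] mink_commute[of c' a] mink_commute[of c a'] mink_commute[of c' a']
    mink_commute[of c b] mink_commute[of c' b] mink_commute[of c b'] mink_commute[of c' b']
  \<comment> \<open>The fourth frame vector \<open>c + c'\<close> turns proportionality into
    equality: its product with either sum is -4. The frame vectors are non-null because the products
    of opposite vectors are neither 1 nor -1.\<close>
  have "(a + a') - (b + b') = 0"
    by (rule mink_orthogonal_basis[of "a - a'" "b - b'" "c - c'" "c + c'"])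
      (use opp in \<open>auto simp: mink_lin sym unit ab ac bc\<close>)
  then show ?thesis by simp
qed

text \<open>Equivalently, antipodal vectors are \<open>w + e\<close> and \<open>w - e\<close>, where
  the three vectors \<open>e\<close> are orthogonal to each other and to \<open>w\<close>, of norm
  2, while \<open>w\<close> has norm -1.\<close>

locale octahedron =
  fixes v :: "nat \<Rightarrow> minkowski" and w :: minkowski and S :: "eplane set set"
  assumes S: "S = (locus \<circ> v) ` {..<6}"
    and unit: "i < 6 \<Longrightarrow> mink (v i) (v i) = 1"
    and adj: "i < 6 \<Longrightarrow> j < 6 \<Longrightarrow> i mod 3 \<noteq> j mod 3 \<Longrightarrow> mink (v i) (v j) = -1"
    and opp: "i < 6 \<Longrightarrow> v i + v ((i + 3) mod 6) = 2 *\<^sub>R w"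
    and vw: "i < 6 \<Longrightarrow> mink (v i) w = -1"
    and ww: "mink w w = -1"
    and tangent: "i < 6 \<Longrightarrow> j < 6 \<Longrightarrow> tangent (locus (v i)) (locus (v j)) \<longleftrightarrow> i mod 3 \<noteq> j mod 3"

lemma octahedral_configuration_vec:
  assumes "octahedral_configuration S"
  shows "\<exists>v w. octahedron v w S"
proof -
  obtain I u where side: "\<forall>C\<in>S. side_of C (I C)" and dis: "disjoint_family_on I S"
    and u: "bij_betw u {..<6} S" and tan: "\<forall>i<6. \<forall>j<6. tangent (u i) (u j) \<longleftrightarrow> octahedron_adj i j"
    using assms unfolding octahedral_configuration_def by blast
  have uS: "u i \<in> S" if "i < 6" for i using u that by (auto simp: bij_betw_def)
  then have "\<forall>i. \<exists>x. i < 6 \<longrightarrow> mink x x = 1 \<and> u i = locus x \<and> I (u i) = pos x \<and> pos x \<noteq> {}"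
    using side side_of_vec by metis
  then obtain v where v: "\<And>i. i < 6 \<Longrightarrow> mink (v i) (v i) = 1" "\<And>i. i < 6 \<Longrightarrow> u i = locus (v i)"
    "\<And>i. i < 6 \<Longrightarrow> I (u i) = pos (v i)" "\<And>i. i < 6 \<Longrightarrow> pos (v i) \<noteq> {}" by metis
  have neq: "u i \<noteq> u j" if "i < 6" "j < 6" "i \<noteq> j" for i j
    using u that by (auto simp: bij_betw_def inj_on_def)
  have tan': "tangent (locus (v i)) (locus (v j)) \<longleftrightarrow> i mod 3 \<noteq> j mod 3" if "i < 6" "j < 6" for i j
    using tan that v(2) by (auto simp: octahedron_adj_def)
  have adj: "mink (v i) (v j) = -1" if ij: "i < 6" "j < 6" "i mod 3 \<noteq> j mod 3" for i j
  proof (rule tangent_disjoint_pos)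
    have "I (u i) \<inter> I (u j) = {}" using dis uS neq ij unfolding disjoint_family_on_def by metis
    then show "pos (v i) \<inter> pos (v j) = {}" using v(3) ij by simp
  qed (use v ij tan' in auto)
  \<comment> \<open>Antipodal circles are distinct and not tangent, so \<open>tangent_locusI\<close>
    excludes a product of absolute value 1.\<close>
  have opp: "\<bar>mink (v i) (v j)\<bar> \<noteq> 1" if "i < 6" "j < 6" "i mod 3 = j mod 3" "i \<noteq> j" for i j
    using tangent_locusI[of "v i" "v j"] tan' that neq v by auto
  have s: "v 0 + v 3 = v 1 + v 4" "v 0 + v 3 = v 2 + v 5"
    by (rule opposite_sum_eq[of _ _ _ _ "v 2" "v 5"] opposite_sum_eq[of _ _ _ _ "v 1" "v 4"];
        use v(1) adj opp in simp)+
  define w where "w = (1 / 2) *\<^sub>R (v 0 + v 3)"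
  have w1: "2 *\<^sub>R w = v 0 + v 3" by (simp add: w_def)
  note w = w1 w1[unfolded s(1)] w1[unfolded s(2)]
  have opp': "v i + v ((i + 3) mod 6) = 2 *\<^sub>R w" if "i < 6" for i
  proof -
    have m: "(0 + 3) mod 6 = (3::nat)" "(1 + 3) mod 6 = (4::nat)" "(2 + 3) mod 6 = (5::nat)"
      "(3 + 3) mod 6 = (0::nat)" "(4 + 3) mod 6 = (1::nat)" "(5 + 3) mod 6 = (2::nat)" by simp_all
    have "i = 0 \<or> i = 1 \<or> i = 2 \<or> i = 3 \<or> i = 4 \<or> i = 5" using that by arith
    then show ?thesis by (elim disjE) (metis m w add.commute)+
  qed
  \<comment> \<open>Here \<open>w\<close> is written as half the sum of an antipodal pair not
    containing \<open>i\<close>; both members are adjacent to \<open>i\<close>.\<close>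
  have vw: "mink (v i) w = -1" if "i < 6" for i
  proof -
    have "mink (v i) (2 *\<^sub>R w) = -2"
    proof (cases "i mod 3 = 0")
      case True
      then show ?thesis using adj[of i 1] adj[of i 4] that unfolding w(2) by (simp add: mink_add_right)
    next
      case False
      then show ?thesis using adj[of i 0] adj[of i 3] that unfolding w(1) by (simp add: mink_add_right)
    qed
    then show ?thesis by (simp add: mink_lin)
  qed
  have "mink w (2 *\<^sub>R w) = -2"
    unfolding w(1) using vw[of 0] vw[of 3] by (simp add: mink_add_right mink_commute[of w])
  then have "mink w w = -1" by (simp add: mink_lin)
  then have "octahedron v w S"
    using v opp' adj vw tan' u by (unfold_locales) (auto simp: bij_betw_def)
  then show ?thesis by blast
qed

text \<open>Reflections are self-adjoint, so the reflection can be moved from the point vector to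
  the vector of the circle.\<close>

lemma locus_image:
  assumes "\<And>p. f (f p) = p" "\<And>p. \<exists>l. l \<noteq> 0 \<and> mrefl d (pt p) = l *\<^sub>R pt (f p)"
  shows "f ` locus x = locus (mrefl d x)"
proof (intro Set.set_eqI)
  fix q
  have "q \<in> f ` locus x \<longleftrightarrow> f q \<in> locus x" using assms(1) by (metis image_iff)
  also have "\<dots> \<longleftrightarrow> mink x (mrefl d (pt q)) = 0"
    using assms(2)[of q] by (auto simp: locus_def mink_lin)
  finally show "q \<in> f ` locus x \<longleftrightarrow> q \<in> locus (mrefl d x)"
    by (simp add: locus_def mink_mrefl_left)
qed

section \<open>Dual circles of the faces\<close>

context octahedron
begin

definition face :: "nat \<Rightarrow> nat \<Rightarrow> nat \<Rightarrow> bool" where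
  "face i j k \<longleftrightarrow> i < 6 \<and> j < 6 \<and> k < 6 \<and> i mod 3 \<noteq> j mod 3 \<and> j mod 3 \<noteq> k mod 3 \<and> i mod 3 \<noteq> k mod 3"

text \<open>For a face this is \<open>sqrt 2\<close> times, up to sign, the unit vector of the dual
  circle: it is orthogonal to the three circles and has norm 2.\<close>

definition fvec :: "nat \<Rightarrow> nat \<Rightarrow> nat \<Rightarrow> minkowski" where
  "fvec i j k = w - v i - v j - v k"

text \<open>The norm 2 of \<open>fvec\<close> absorbs the factor 2 of \<open>mrefl\<close>, so this
  is the reflection in the dual circle without normalisation.\<close>

definition frefl :: "nat \<Rightarrow> nat \<Rightarrow> nat \<Rightarrow> minkowski \<Rightarrow> minkowski" where
  "frefl i j k x = x - mink (fvec i j k) x *\<^sub>R fvec i j k"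

lemma wv: "i < 6 \<Longrightarrow> mink w (v i) = -1"
  using vw by (simp add: mink_commute)

lemma frame_zero:
  assumes "face i j k" "mink u (v i) = 0" "mink u (v j) = 0" "mink u (v k) = 0" "mink u w = 0"
  shows "u = 0"
  by (rule mink_orthogonal_basis[of "v i - w" "v j - w" "v k - w" w])
    (use assms in \<open>auto simp: face_def mink_lin unit adj vw ww wv\<close>)

lemma fvec_mink:
  assumes "face i j k"
  shows "mink (fvec i j k) (v i) = 0" "mink (fvec i j k) (v j) = 0" "mink (fvec i j k) (v k) = 0"
    "mink (fvec i j k) w = 2" "mink (fvec i j k) (fvec i j k) = 2"
  using assms by (auto simp: face_def fvec_def mink_lin unit adj vw ww wv)

text \<open>The tangency point is \<open>v a + v b\<close> up to a scalar, so incidence is a linear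
  condition on \<open>d\<close>. The product of this sum with \<open>w\<close> is -2, so the sum is
  nonzero.\<close>

lemma tangency_point_in_locus:
  assumes ab: "a < 6" "b < 6" "a mod 3 \<noteq> b mod 3"
  shows "locus (v a) \<inter> locus (v b) \<subseteq> locus d \<longleftrightarrow> mink d (v a) + mink d (v b) = 0"
proof -
  have "mink (v a + v b) (v a + v b) = 0" "mink (v a + v b) w \<noteq> 0"
    using ab unit[of a] unit[of b] adj[of a b] by (auto simp: mink_add_left mink_add_right vw mink_commute[of "v b" "v a"])
  then obtain l p where lp: "l \<noteq> 0" "v a + v b = l *\<^sub>R pt p" by (metis null_vec mink_zero(1))
  have "locus (v a) \<inter> locus (v b) = {p}"
    using locus_Int_tangent[OF unit unit adj lp(2,1)] ab by simp
  moreover have "mink d (v a) + mink d (v b) = l * mink d (pt p)"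
    using arg_cong[OF lp(2), of "mink d"] by (simp add: mink_add_right mink_scale_right)
  ultimately show ?thesis using lp by (simp add: locus_def)
qed

text \<open>The three pairwise sums of \<open>mink d (v i)\<close>, \<open>mink d (v j)\<close>,
  \<open>mink d (v k)\<close> vanish only if each term does. Passing through the tangency points
  therefore means orthogonality to the circles, which leaves a single direction in dimension
  4.\<close>

lemma dual_vec:
  assumes ijk: "face i j k" and d: "mink d d = 1" and
    sub: "locus (v i) \<inter> locus (v j) \<subseteq> locus d" "locus (v j) \<inter> locus (v k) \<subseteq> locus d"
    "locus (v i) \<inter> locus (v k) \<subseteq> locus d"
  shows "mrefl d = frefl i j k"
proof -
  have dv: "mink d (v i) = 0" "mink d (v j) = 0" "mink d (v k) = 0"
    using tangency_point_in_locus[of i j d] tangency_point_in_locus[of j k d]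
      tangency_point_in_locus[of i k d] ijk sub by (auto simp: face_def)
  define F where "F = fvec i j k"
  have F: "mink F (v i) = 0" "mink F (v j) = 0" "mink F (v k) = 0" "mink F w = 2" "mink F F = 2"
    using fvec_mink[OF ijk] by (simp_all add: F_def)
  define m where "m = mink d w / 2"
  have "d - m *\<^sub>R F = 0"
    using ijk by (rule frame_zero) (simp_all add: dv F mink_lin m_def)
  then have dF: "d = m *\<^sub>R F" by simp
  then have "2 * m\<^sup>2 = 1" using d F by (simp add: mink_lin power2_eq_square)
  then have "2 * m * m = 1" by (simp add: power2_eq_square)
  then show ?thesis
    by (auto simp: fun_eq_iff mrefl_def frefl_def dF mink_lin simp flip: F_def)
qed

lemma generator_frefl:
  assumes D: "D \<in> dual_circles S" and f: "inversion_in D f"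
  shows "\<exists>i j k. face i j k \<and> (\<forall>x. f ` locus x = locus (frefl i j k x))"
proof -
  obtain d where d: "mink d d = 1" "D = locus d" "\<And>p. f (f p) = p"
    "\<And>p. \<exists>l. l \<noteq> 0 \<and> mrefl d (pt p) = l *\<^sub>R pt (f p)"
    using inversion_in_vec[OF f] by metis
  obtain A B C where ABC: "A \<in> S" "B \<in> S" "C \<in> S" "tangent A B" "tangent B C" "tangent A C"
     "A \<inter> B \<subseteq> D" "B \<inter> C \<subseteq> D" "A \<inter> C \<subseteq> D" using D unfolding dual_circles_def by blast
  obtain i j k where ijk: "A = locus (v i)" "B = locus (v j)" "C = locus (v k)" "i < 6" "j < 6" "k < 6"
    using ABC S by auto
  then have "face i j k" using ABC tangent by (auto simp: face_def)
  moreover have "mrefl d = frefl i j k"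
    using calculation d ABC ijk by (intro dual_vec) auto
  ultimately show ?thesis using locus_image[of f d] d by metis
qed

lemma frefl_generator:
  assumes ijk: "face i j k"
  shows "\<exists>D f. D \<in> dual_circles S \<and> inversion_in D f \<and> (\<forall>x. f ` locus x = locus (frefl i j k x))"
proof -
  define d where "d = (1 / sqrt 2) *\<^sub>R fvec i j k"
  have "mink d d = 1" using fvec_mink[OF ijk] by (simp add: d_def mink_lin)
  then have gen: "generalized_circle (locus d)" by (rule generalized_circle_locus)
  then obtain f where f: "inversion_in (locus d) f"
    unfolding generalized_circle_def by (metis inversion_in.intros)
  obtain d' where d': "mink d' d' = 1" "locus d = locus d'" "\<And>p. f (f p) = p"
    "\<And>p. \<exists>l. l \<noteq> 0 \<and> mrefl d' (pt p) = l *\<^sub>R pt (f p)"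
    using inversion_in_vec[OF f] by metis
  have sub': "locus (v i) \<inter> locus (v j) \<subseteq> locus d" "locus (v j) \<inter> locus (v k) \<subseteq> locus d"
    "locus (v i) \<inter> locus (v k) \<subseteq> locus d"
    using ijk fvec_mink[OF ijk] by (simp_all add: tangency_point_in_locus d_def face_def mink_scale_left)
  have "mrefl d' = frefl i j k" using sub' d' by (intro dual_vec[OF ijk]) auto
  then have "\<forall>x. f ` locus x = locus (frefl i j k x)" using locus_image[of f d'] d' by metis
  moreover have "locus d \<in> dual_circles S"
    unfolding dual_circles_def using gen sub' ijk S tangent
    by (auto simp: face_def)
  ultimately show ?thesis using f by blast
qed

end

section \<open>The octahedral Apollonian group\<close>

text \<open>Generators are their own inverses, so the group is the closure of \<open>H\<close> and
  \<open>id\<close> under plain composition.\<close>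

lemma generate_involutions:
  fixes H :: "('a \<Rightarrow> 'a) set"
  assumes inv: "\<forall>f\<in>H. \<forall>p. f (f p) = p"
  shows generate_id: "id \<in> generate (BijGroup UNIV) H"
    and generate_comp: "g \<in> generate (BijGroup UNIV) H \<Longrightarrow> h \<in> generate (BijGroup UNIV) H \<Longrightarrow>
      g \<circ> h \<in> generate (BijGroup UNIV) H"
    and generate_induct: "g \<in> generate (BijGroup UNIV) H \<Longrightarrow> Q id \<Longrightarrow> (\<And>f. f \<in> H \<Longrightarrow> Q f) \<Longrightarrow>
      (\<And>g h. Q g \<Longrightarrow> Q h \<Longrightarrow> Q (g \<circ> h)) \<Longrightarrow> Q g"
    and generate_inverse: "g \<in> generate (BijGroup UNIV) H \<Longrightarrow>
      \<exists>h\<in>generate (BijGroup UNIV) H. g \<circ> h = id \<and> h \<circ> g = id"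
proof -
  have H: "f (f p) = p" if "f \<in> H" for f p using inv that by blast
  interpret group "BijGroup (UNIV :: 'a set)" by (rule group_BijGroup)
  have one_eq: "\<one>\<^bsub>BijGroup UNIV\<^esub> = (id :: 'a \<Rightarrow> 'a)" by (simp add: BijGroup_def restrict_def id_def)
  have car: "f \<in> carrier (BijGroup UNIV)" if "f \<in> H" for f
  proof -
    have "bij f" using H[OF that] by (intro o_bij[of f f]) (auto simp: fun_eq_iff)
    then show ?thesis by (simp add: BijGroup_def Bij_def)
  qed
  then have gen: "g \<in> carrier (BijGroup UNIV)" if "g \<in> generate (BijGroup UNIV) H" for g
    using generate_in_carrier[OF _ that] by blast
  have mult_eq: "g \<otimes>\<^bsub>BijGroup UNIV\<^esub> h = g \<circ> h"
    if "g \<in> carrier (BijGroup UNIV)" "h \<in> carrier (BijGroup UNIV)" for g h :: "'a \<Rightarrow> 'a"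
    using that by (simp add: BijGroup_def compose_def fun_eq_iff)
  have inv_eq: "inv\<^bsub>BijGroup UNIV\<^esub> f = f" if "f \<in> H" for f
    using car[OF that] H[OF that] by (intro inv_equality) (auto simp: mult_eq one_eq fun_eq_iff)
  show id: "id \<in> generate (BijGroup UNIV) H" using generate.one[of "BijGroup UNIV" H] one_eq by simp
  show comp: "g \<circ> h \<in> generate (BijGroup UNIV) H"
    if "g \<in> generate (BijGroup UNIV) H" "h \<in> generate (BijGroup UNIV) H" for g h
    using generate.eng[OF that] mult_eq gen that by simp
  show ind: "Q g" if g: "g \<in> generate (BijGroup UNIV) H" and Q: "Q id" "\<And>f. f \<in> H \<Longrightarrow> Q f"
      "\<And>g h. Q g \<Longrightarrow> Q h \<Longrightarrow> Q (g \<circ> h)" for g Q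
    using g
  proof induction
    case one
    then show ?case unfolding one_eq by (rule Q(1))
  next
    case (incl h)
    then show ?case using Q by simp
  next
    case (inv h)
    then show ?case using Q inv_eq by simp
  next
    case (eng h1 h2)
    show ?case unfolding mult_eq[OF gen[OF eng.hyps(1)] gen[OF eng.hyps(2)]] by (rule Q(3)[OF eng.IH])
  qed
  show "\<exists>h\<in>generate (BijGroup UNIV) H. g \<circ> h = id \<and> h \<circ> g = id"
    if "g \<in> generate (BijGroup UNIV) H" for g
    using that
  proof (rule ind)
    show "\<exists>h\<in>generate (BijGroup UNIV) H. id \<circ> h = id \<and> h \<circ> id = id" using id by auto
    show "\<exists>h\<in>generate (BijGroup UNIV) H. f \<circ> h = id \<and> h \<circ> f = id" if "f \<in> H" for f
      using that H by (intro bexI[of _ f]) (auto simp: fun_eq_iff intro: generate.incl)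
    fix g h
    assume "\<exists>g'\<in>generate (BijGroup UNIV) H. g \<circ> g' = id \<and> g' \<circ> g = id"
      "\<exists>h'\<in>generate (BijGroup UNIV) H. h \<circ> h' = id \<and> h' \<circ> h = id"
    then obtain g' h' where "g' \<in> generate (BijGroup UNIV) H" "h' \<in> generate (BijGroup UNIV) H"
      "g \<circ> g' = id" "g' \<circ> g = id" "h \<circ> h' = id" "h' \<circ> h = id" by blast
    then show "\<exists>f\<in>generate (BijGroup UNIV) H. (g \<circ> h) \<circ> f = id \<and> f \<circ> (g \<circ> h) = id"
      by (intro bexI[of _ "h' \<circ> g'"] comp) (auto simp: fun_eq_iff)
  qed
qed

section \<open>Curvature as a coordinate\<close>

lemma has_curvature_unique:
  assumes "has_curvature P C k" "has_curvature P C l"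
  shows "k = l"
proof -
  have ne: "circle c r \<noteq> line u d" for c r u d by (auto simp: circle_def line_def)
  have eq: "c = c' \<and> r = r'" if "circle c r = circle c' r'" "r > 0" "r' > 0" for c c' r r'
  proof -
    have "sphere c r = sphere c' r'"
      using that(1) by (simp add: circle_def inj_image_eq_iff)
    then have on: "(cmod (c + w - c'))\<^sup>2 = r'\<^sup>2" if "cmod w = r" for w
      using that by (auto simp: set_eq_iff dist_norm norm_minus_commute)
    \<comment> \<open>Two pairs of antipodal points of the first circle lie on the second;
      subtracting within each pair identifies the centres.\<close>
    have "(Re c + r - Re c')\<^sup>2 + (Im c - Im c')\<^sup>2 = r'\<^sup>2" "(Re c - r - Re c')\<^sup>2 + (Im c - Im c')\<^sup>2 = r'\<^sup>2"
      "(Re c - Re c')\<^sup>2 + (Im c + r - Im c')\<^sup>2 = r'\<^sup>2" "(Re c - Re c')\<^sup>2 + (Im c - r - Im c')\<^sup>2 = r'\<^sup>2"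
      using that on[of "of_real r"] on[of "- of_real r"] on[of "\<i> * of_real r"] on[of "- \<i> * of_real r"]
      by (simp_all add: cmod_power2 norm_mult)
    moreover have "(x + r - y)\<^sup>2 - (x - r - y)\<^sup>2 = 4 * r * (x - y)" for x y
      by (simp add: power2_eq_square algebra_simps)
    ultimately have "4 * r * (Re c - Re c') = 0" "4 * r * (Im c - Im c') = 0"
      by (smt (verit))+
    then have "c = c'" using that by (simp add: complex_eq_iff)
    moreover from this have "r\<^sup>2 = r'\<^sup>2" using on[of "of_real r"] that by simp
    ultimately show ?thesis using that by simp
  qed
  show ?thesis
    using assms
  proof (cases rule: has_curvature.cases[OF assms(1)])
    case (1 u d)
    show ?thesis using assms(2) 1 ne by (cases rule: has_curvature.cases) auto
  next
    case (2 r c)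
    show ?thesis
    proof (cases rule: has_curvature.cases[OF assms(2)])
      case 1
      then show ?thesis using 2 ne by metis
    next
      case (2 r' c')
      then show ?thesis using \<open>C = circle c r\<close> \<open>r > 0\<close> \<open>k = 1 / r\<close> eq by metis
    next
      case (3 r' c')
      then have "c = c'" "r = r'" using \<open>C = circle c r\<close> \<open>r > 0\<close> eq by metis+
      then show ?thesis using 3 2 by blast
    qed
  next
    case (3 r c)
    show ?thesis
    proof (cases rule: has_curvature.cases[OF assms(2)])
      case 1
      then show ?thesis using 3 ne by metis
    next
      case (2 r' c')
      then have "c = c'" "r = r'" using \<open>C = circle c r\<close> \<open>r > 0\<close> eq by metis+
      then show ?thesis using 3 2 by blast
    next
      case (3 r' c')
      then show ?thesis using \<open>C = circle c r\<close> \<open>r > 0\<close> \<open>k = - 1 / r\<close> eq by metis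
    qed
  qed
qed

text \<open>The sign is determined when \<open>P\<close> contains a line: the line passes through
  infinity and lies in no disc, so no circle can contain all the others.\<close>

lemma curvature_locus:
  assumes "mink x x = 1"
  shows "\<bar>curvature P (locus x)\<bar> = \<bar>fst x\<bar>"
    and "locus y \<in> P \<Longrightarrow> fst y = 0 \<Longrightarrow> fst x \<noteq> 0 \<Longrightarrow> curvature P (locus x) > 0"
proof -
  have cur: "curvature P C = k" if "has_curvature P C k" for C k
    unfolding curvature_def using that has_curvature_unique by (intro the_equality) auto
  show "\<bar>curvature P (locus x)\<bar> = \<bar>fst x\<bar>"
  proof (cases rule: unit_vec_cases[OF assms])
    case (1 c r)
    note circ = this
    have "has_curvature P (circle c r) (1 / r) \<or> has_curvature P (circle c r) (- 1 / r)"
    proof (cases "\<exists>C'\<in>P - {circle c r}. \<not> C' \<subseteq> Some ` cball c r")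
      case True
      then show ?thesis using has_curvature.intros(2)[OF circ(1)] by blast
    next
      case False
      then have "\<forall>C'\<in>P - {circle c r}. C' \<subseteq> Some ` cball c r" by blast
      from has_curvature.intros(3)[OF circ(1) this] show ?thesis by (rule disjI2)
    qed
    then have "curvature P (locus x) = 1 / r \<or> curvature P (locus x) = - 1 / r"
      unfolding circ(3) using cur by blast
    then show ?thesis using circ(1,2) by (elim disjE) simp_all
  next
    case (2 u d)
    note lin = this
    then have "curvature P (locus x) = 0" using cur[OF has_curvature.intros(1)[OF lin(1)]] by simp
    then show ?thesis using lin by simp
  qed
  assume y: "locus y \<in> P" "fst y = 0" and x: "fst x \<noteq> 0"
  then have None: "None \<in> locus y" by (simp add: locus_def mink_def)
  show "curvature P (locus x) > 0"
  proof (cases rule: unit_vec_cases[OF assms])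
    case (1 c r)
    note circ = this
    have "\<not> locus y \<subseteq> Some ` cball c r" "locus y \<noteq> circle c r" using None by (auto simp: circle_def)
    then have "has_curvature P (circle c r) (1 / r)"
      using y circ(1) by (intro has_curvature.intros) auto
    then show ?thesis unfolding circ(3) using cur circ(1) by simp
  qed (use x in simp)
qed

lemma tangent_image: "inj f \<Longrightarrow> tangent A B \<Longrightarrow> tangent (f ` A) (f ` B)"
  unfolding tangent_def by (metis image_Int image_empty image_insert)

lemma tangent_sym: "tangent A B \<Longrightarrow> tangent B A"
  by (simp add: tangent_def Int_commute)

lemma eq_or_antipodal:
  fixes m n :: nat
  assumes "m < 6" "n < 6" "m mod 3 = n mod 3"
  shows "m = n \<or> m = (n + 3) mod 6"
proof -
  have six: "x = 0 \<or> x = 1 \<or> x = 2 \<or> x = 3 \<or> x = 4 \<or> x = 5" if "x < 6" for x :: nat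
    using that by arith
  show ?thesis using six[OF assms(1)] six[OF assms(2)] assms(3) by (elim disjE) simp_all
qed

context octahedron
begin

abbreviation "\<Gamma> \<equiv> octahedral_apollonian_group S"

lemma dual_inversion_involution: "\<forall>f\<in>{f. \<exists>D\<in>dual_circles S. inversion_in D f}. \<forall>p. f (f p) = p"
proof (intro ballI allI)
  fix f p assume "f \<in> {f. \<exists>D\<in>dual_circles S. inversion_in D f}"
  then obtain D where "inversion_in D f" by blast
  then show "f (f p) = p" by (rule inversion_in_vec)
qed

lemmas group_id = generate_id[OF dual_inversion_involution, folded octahedral_apollonian_group_def]
  and group_comp = generate_comp[OF dual_inversion_involution, folded octahedral_apollonian_group_def]
  and group_inverse = generate_inverse[OF dual_inversion_involution, folded octahedral_apollonian_group_def]
  and group_induct = generate_induct[OF dual_inversion_involution, folded octahedral_apollonian_group_def]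

lemma group_inj: "g \<in> \<Gamma> \<Longrightarrow> inj g"
  using group_inverse by (metis inj_on_id inj_on_imageI2)

lemma frefl_in_group:
  assumes "face i j k"
  obtains f where "f \<in> \<Gamma>" "\<And>x. f ` locus x = locus (frefl i j k x)"
proof -
  obtain D f where "D \<in> dual_circles S" "inversion_in D f" "\<forall>x. f ` locus x = locus (frefl i j k x)"
    using frefl_generator[OF assms] by blast
  moreover then have "f \<in> \<Gamma>" unfolding octahedral_apollonian_group_def by (intro generate.incl) blast
  ultimately show ?thesis using that by blast
qed

text \<open>Quantifying over all functionals \<open>\<kappa>\<close> makes the property closed under composition.\<close>

definition preserves_lattice :: "(minkowski \<Rightarrow> minkowski) \<Rightarrow> bool" where
  "preserves_lattice L \<longleftrightarrow> (\<forall>\<kappa> (l::int). linear \<kappa> \<longrightarrow> (\<forall>i<6. \<exists>c::int. \<kappa> (v i) = of_int (l * c)) \<longrightarrow>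
     (\<forall>i<6. \<exists>c::int. \<kappa> (L (v i)) = (of_int (l * c) :: real)))"

lemma linear_frefl: "linear (frefl i j k)"
  by (rule linearI) (simp_all add: frefl_def mink_lin algebra_simps scaleR_add_left)

lemma mink_frefl: "face i j k \<Longrightarrow> mink (frefl i j k x) (frefl i j k y) = mink x y"
  using fvec_mink(5)[of i j k] by (simp add: frefl_def mink_lin mink_commute[of x "fvec i j k"] algebra_simps)

lemma frefl_fix:
  assumes "face i j k"
  shows "frefl i j k (v i) = v i" "frefl i j k (v j) = v j" "frefl i j k (v k) = v k"
  using fvec_mink[OF assms] by (simp_all add: frefl_def)

lemma opposite_cases:
  assumes "face i j k" "m < 6"
  shows "m \<in> {i, j, k} \<or> (\<exists>n\<in>{i, j, k}. m = (n + 3) mod 6)"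
proof -
  have three: "a = b \<or> a = c \<or> a = d"
    if "a < 3" "b < 3" "c < 3" "d < 3" "b \<noteq> c" "c \<noteq> d" "b \<noteq> d" for a b c d :: nat
    using that by linarith
  have m3: "m mod 3 = i mod 3 \<or> m mod 3 = j mod 3 \<or> m mod 3 = k mod 3"
    using assms(1) by (intro three) (auto simp: face_def)
  have eq: "m = n \<or> m = (n + 3) mod 6" if "m mod 3 = n mod 3" "n < 6" for n
    using eq_or_antipodal assms(2) that by blast
  show ?thesis
  proof -
    consider "m mod 3 = i mod 3" | "m mod 3 = j mod 3" | "m mod 3 = k mod 3" using m3 by blast
    then show ?thesis by cases (use eq assms(1) in \<open>auto simp: face_def\<close>)
  qed
qed

lemma preserves_lattice_frefl:
  assumes ijk: "face i j k"
  shows "preserves_lattice (frefl i j k)"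
  unfolding preserves_lattice_def
proof (intro allI impI)
  fix \<kappa> :: "minkowski \<Rightarrow> real" and l :: int and m :: nat
  assume \<kappa>: "linear \<kappa>" and lat: "\<forall>i<6. \<exists>c::int. \<kappa> (v i) = of_int (l * c)" and m: "m < 6"
  consider "m \<in> {i, j, k}" | n where "n \<in> {i, j, k}" "m = (n + 3) mod 6"
    using opposite_cases[OF ijk m] by blast
  then show "\<exists>c::int. \<kappa> (frefl i j k (v m)) = of_int (l * c)"
  proof cases
    case 1
    then have "frefl i j k (v m) = v m" using frefl_fix[OF ijk] by auto
    then show ?thesis using lat m by simp
  next
    case 2
    then have n: "n < 6" using ijk by (auto simp: face_def)
    have vm: "v m = 2 *\<^sub>R w - v n" using opp[OF n] 2 by (simp add: algebra_simps)
    have "mink (fvec i j k) (v m) = 4"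
      using fvec_mink[OF ijk] 2 unfolding vm by (auto simp: mink_diff_right mink_scale_right)
    then have "frefl i j k (v m) = v m - 4 *\<^sub>R fvec i j k" by (simp add: frefl_def)
    \<comment> \<open>In terms of the six vectors \<open>w\<close> is only a half-integral
      combination; the coefficient 4 clears the denominator.\<close>
    also have "\<dots> = v m - 2 *\<^sub>R (v n + v m) + 4 *\<^sub>R (v i + v j + v k)"
      using opp[OF n] 2 by (simp add: fvec_def algebra_simps)
    finally have e: "\<kappa> (frefl i j k (v m)) = \<kappa> (v m) - 2 * (\<kappa> (v n) + \<kappa> (v m)) + 4 * (\<kappa> (v i) + \<kappa> (v j) + \<kappa> (v k))"
      by (simp add: linear_add[OF \<kappa>] linear_diff[OF \<kappa>] linear_scale[OF \<kappa>])
    obtain cm cn ci cj ck :: int where "\<kappa> (v m) = of_int (l * cm)" "\<kappa> (v n) = of_int (l * cn)"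
      "\<kappa> (v i) = of_int (l * ci)" "\<kappa> (v j) = of_int (l * cj)" "\<kappa> (v k) = of_int (l * ck)"
      using lat m n ijk unfolding face_def by meson
    then have "\<kappa> (frefl i j k (v m)) = of_int (l * (cm - 2 * (cn + cm) + 4 * (ci + cj + ck)))"
      unfolding e by (simp add: algebra_simps)
    then show ?thesis by blast
  qed
qed

definition realises :: "(eplane \<Rightarrow> eplane) \<Rightarrow> (minkowski \<Rightarrow> minkowski) \<Rightarrow> bool" where
  "realises g L \<longleftrightarrow> linear L \<and> (\<forall>x y. mink (L x) (L y) = mink x y) \<and> preserves_lattice L \<and>
     (\<forall>x. g ` locus x = locus (L x))"

lemma realises_comp:
  assumes LM: "realises g L" "realises h M"
  shows "realises (g \<circ> h) (L \<circ> M)"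
proof -
  have "preserves_lattice (L \<circ> M)"
    unfolding preserves_lattice_def
  proof (intro allI impI)
    fix \<kappa> :: "minkowski \<Rightarrow> real" and l :: int and i :: nat
    assume \<kappa>: "linear \<kappa>" and lat: "\<forall>i<6. \<exists>c::int. \<kappa> (v i) = of_int (l * c)" and i: "i < 6"
    have "linear (\<kappa> \<circ> L)" using \<kappa> LM by (simp add: realises_def linear_compose)
    moreover have "\<forall>i<6. \<exists>c::int. (\<kappa> \<circ> L) (v i) = of_int (l * c)"
      using LM(1) \<kappa> lat unfolding realises_def preserves_lattice_def comp_apply by blast
    ultimately have "\<exists>c::int. (\<kappa> \<circ> L) (M (v i)) = of_int (l * c)"
      using LM(2) i unfolding realises_def preserves_lattice_def by blast
    then show "\<exists>c::int. \<kappa> ((L \<circ> M) (v i)) = of_int (l * c)" by simp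
  qed
  moreover have "linear (L \<circ> M)" using LM by (simp add: realises_def linear_compose)
  moreover have "(g \<circ> h) ` locus x = locus ((L \<circ> M) x)" for x
  proof -
    have "h ` locus x = locus (M x)" "g ` locus (M x) = locus (L (M x))"
      using LM unfolding realises_def by blast+
    then show ?thesis by (simp only: image_comp[symmetric] o_apply)
  qed
  moreover have "mink ((L \<circ> M) x) ((L \<circ> M) y) = mink x y" for x y
    using LM unfolding realises_def o_apply by metis
  ultimately show ?thesis unfolding realises_def by blast
qed

lemma group_realised:
  assumes "g \<in> \<Gamma>" shows "\<exists>L. realises g L"
  using assms
proof (rule group_induct)
  show "\<exists>L. realises id L"
    by (rule exI[of _ id]) (simp add: realises_def preserves_lattice_def linear_id)
  show "\<exists>L. realises f L" if "f \<in> {f. \<exists>D\<in>dual_circles S. inversion_in D f}" for f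
  proof -
    from that obtain D where D: "D \<in> dual_circles S" "inversion_in D f" by blast
    obtain i j k where "face i j k" "\<forall>x. f ` locus x = locus (frefl i j k x)"
      using generator_frefl[OF D] by blast
    then show ?thesis
      by (intro exI[of _ "frefl i j k"]) (simp add: realises_def linear_frefl mink_frefl preserves_lattice_frefl)
  qed
  show "\<exists>L. realises (g \<circ> h) L" if "\<exists>L. realises g L" "\<exists>L. realises h L" for g h
    using that realises_comp by blast
qed

text \<open>The reflections in the two faces at the edge \<open>i j\<close> fix \<open>v i\<close>
  and \<open>v j\<close>. Their composition is parabolic: it fixes the null vector
  \<open>v i + v j\<close> of the tangency point and is unipotent on the span of this vector,
  \<open>fvec i j k\<close> and \<open>v k\<close>. Its powers are thus quadratic in
  \<open>m\<close>.\<close>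

lemma chain:
  assumes ijk: "face i j k"
  shows "\<exists>\<sigma>\<in>\<Gamma>. \<sigma> ` locus (v i) = locus (v i) \<and>
    \<sigma> ` locus (v k) = locus (v k + (4 * real m) *\<^sub>R fvec i j k + (8 * (real m)\<^sup>2) *\<^sub>R (v i + v j))"
proof -
  define k' where "k' = (k + 3) mod 6"
  have ijk': "face i j k'" using ijk by (auto simp: face_def k'_def mod_mod_cancel)
  define F where "F = fvec i j k"
  define n where "n = v i + v j"
  have vk': "v k' = 2 *\<^sub>R w - v k" using opp[of k] ijk by (simp add: face_def k'_def algebra_simps)
  have F': "fvec i j k' = - F - 2 *\<^sub>R n"
    by (simp add: fvec_def F_def n_def vk' algebra_simps scaleR_2)
  have mF: "mink F (v i) = 0" "mink F (v j) = 0" "mink F (v k) = 0" "mink F w = 2" "mink F F = 2" "mink F n = 0"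
    using fvec_mink[OF ijk] by (simp_all add: F_def n_def mink_add_right)
  have nk: "mink n (v k) = -2" using ijk by (simp add: n_def mink_add_left adj face_def)
  have nn: "mink n n = 0" using ijk mink_commute[of "v j" "v i"]
    by (simp add: n_def mink_lin unit adj face_def)
  have nF: "mink n F = 0" using mF by (simp add: mink_commute)
  define T where "T = frefl i j k' \<circ> frefl i j k"
  have T: "T (v k) = v k + 4 *\<^sub>R F + 8 *\<^sub>R n" "T F = F + 4 *\<^sub>R n" "T n = n" "T (v i) = v i"
  proof -
    have 1: "frefl i j k (v k) = v k" "frefl i j k F = - F" "frefl i j k n = n" "frefl i j k (v i) = v i"
      using mF by (simp_all add: frefl_def scaleR_2 flip: F_def)
    have 2: "mink (- F - 2 *\<^sub>R n) (v k) = 4" "mink (- F - 2 *\<^sub>R n) (- F) = 2" "mink (- F - 2 *\<^sub>R n) n = 0"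
      by (simp_all add: mink_lin mF nk nn nF)
    show "T (v k) = v k + 4 *\<^sub>R F + 8 *\<^sub>R n" "T F = F + 4 *\<^sub>R n" "T n = n"
      unfolding T_def comp_apply 1 unfolding frefl_def F' 2
      by (simp_all add: prod_eq_iff scaleR_conv_of_real algebra_simps)
    show "T (v i) = v i" unfolding T_def comp_apply 1 by (rule frefl_fix[OF ijk'])
  qed
  have lin: "linear T" unfolding T_def by (intro linear_compose linear_frefl)
  obtain \<tau> where \<tau>: "\<tau> \<in> \<Gamma>" "\<And>x. \<tau> ` locus x = locus (T x)"
  proof -
    obtain f where f: "f \<in> \<Gamma>" "\<And>x. f ` locus x = locus (frefl i j k x)" using frefl_in_group[OF ijk] by metis
    obtain f' where f': "f' \<in> \<Gamma>" "\<And>x. f' ` locus x = locus (frefl i j k' x)" using frefl_in_group[OF ijk'] by metis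
    show ?thesis using that[of "f' \<circ> f"] f f' group_comp[OF f'(1) f(1)]
      unfolding T_def image_comp[symmetric] o_apply by simp
  qed
  show ?thesis
  proof (induction m)
    case 0
    show ?case using group_id by (intro bexI[of _ id]) auto
  next
    case (Suc m)
    then obtain \<sigma> where \<sigma>: "\<sigma> \<in> \<Gamma>" "\<sigma> ` locus (v i) = locus (v i)"
      "\<sigma> ` locus (v k) = locus (v k + (4 * real m) *\<^sub>R F + (8 * (real m)\<^sup>2) *\<^sub>R n)"
      unfolding F_def n_def by blast
    have "T (v k + (4 * real m) *\<^sub>R F + (8 * (real m)\<^sup>2) *\<^sub>R n) =
       v k + (4 * real (Suc m)) *\<^sub>R F + (8 * (real (Suc m))\<^sup>2) *\<^sub>R n"
      unfolding linear_add[OF lin] linear_scale[OF lin] T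
      by (simp add: algebra_simps power2_eq_square)
    then have "(\<tau> \<circ> \<sigma>) ` locus (v k) = locus (v k + (4 * real (Suc m)) *\<^sub>R F + (8 * (real (Suc m))\<^sup>2) *\<^sub>R n)"
      unfolding image_comp[symmetric] \<sigma> \<tau> by simp
    moreover have "(\<tau> \<circ> \<sigma>) ` locus (v i) = locus (v i)" unfolding image_comp[symmetric] \<sigma> \<tau> T ..
    moreover have "\<tau> \<circ> \<sigma> \<in> \<Gamma>" using group_comp \<sigma> \<tau> by blast
    ultimately show ?case unfolding F_def n_def by blast
  qed
qed

text \<open>An octahedral Descartes relation. The first coordinate is -2 times the product with the
  null vector of infinity; expanding that vector in the orthogonal frame and using that its norm is
  0 gives the identity.\<close>

lemma curvature_quadric:
  assumes ijk: "face i j k" and L: "linear L" "\<And>x y. mink (L x) (L y) = mink x y"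
  shows "(fst (L (v i)) - fst (L w))\<^sup>2 + (fst (L (v j)) - fst (L w))\<^sup>2 + (fst (L (v k)) - fst (L w))\<^sup>2
    = 2 * (fst (L w))\<^sup>2"
proof -
  define N where "N = pt None"
  define a b c where "a = L (v i - w)" and "b = L (v j - w)" and "c = L (v k - w)"
  have fst: "fst x = - 2 * mink N x" for x by (simp add: N_def mink_def)
  have gram: "mink a a = 2" "mink b b = 2" "mink c c = 2" "mink (L w) (L w) = -1"
    "mink a b = 0" "mink a c = 0" "mink b c = 0" "mink a (L w) = 0" "mink b (L w) = 0" "mink c (L w) = 0"
    "mink b a = 0" "mink c a = 0" "mink c b = 0" "mink (L w) a = 0" "mink (L w) b = 0" "mink (L w) c = 0"
    using ijk unfolding a_def b_def c_def L(2) face_def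
    by (simp_all add: mink_lin unit adj vw wv ww)
  \<comment> \<open>The difference between \<open>N\<close> and its expansion in the frame; the plus
    sign comes from \<open>L w\<close> having norm -1.\<close>
  define u where "u = N - (mink N a / 2) *\<^sub>R a - (mink N b / 2) *\<^sub>R b - (mink N c / 2) *\<^sub>R c + mink N (L w) *\<^sub>R L w"
  have "u = 0"
    by (rule mink_orthogonal_basis[of a b c "L w"]) (simp_all add: gram u_def mink_lin)
  then have "mink N u = 0" by simp
  then have "(mink N a)\<^sup>2 + (mink N b)\<^sup>2 + (mink N c)\<^sup>2 = 2 * (mink N (L w))\<^sup>2"
    by (simp add: u_def mink_lin N_def[symmetric] power2_eq_square) (simp add: N_def mink_def field_simps)
  then have "(fst a)\<^sup>2 + (fst b)\<^sup>2 + (fst c)\<^sup>2 = 2 * (fst (L w))\<^sup>2"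
    unfolding fst power_mult_distrib by simp
  then show ?thesis by (simp add: a_def b_def c_def linear_diff[OF L(1)])
qed

end

section \<open>Arithmetic\<close>

text \<open>The polynomial in \<open>m\<close> lists the curvatures produced by
  \<open>chain\<close>. It is constant modulo 4, so the parity hypothesis is what deals with the
  prime 2. For a prime dividing both \<open>a\<close> and \<open>q\<close>, \<open>rel\<close> makes
  the linear coefficient vanish, and primitivity keeps the quadratic one nonzero.\<close>

lemma coprime_in_chain:
  fixes a p q h :: int
  assumes rel: "(h - a - p - q)\<^sup>2 = 2 * (a * p + a * q + p * q)"
    and prim: "\<And>l. prime l \<Longrightarrow> l dvd a \<Longrightarrow> l dvd p \<Longrightarrow> l dvd q \<Longrightarrow> l dvd h \<Longrightarrow> False"
    and odd: "odd a \<or> odd q" and a: "a \<noteq> 0"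
  shows "\<exists>m::nat. coprime a (q + 4 * int m * (h - a - p - q) + 8 * (int m)\<^sup>2 * (a + p))"
proof -
  define d where "d = h - a - p - q"
  define M where "M = {l \<in> prime_factors a. \<not> l dvd q}"
  have fin: "finite M" by (simp add: M_def)
  \<comment> \<open>Primes in \<open>M\<close> divide \<open>m\<close> but not \<open>q\<close>; the other prime divisors of \<open>a\<close> divide \<open>q\<close> and \<open>d\<close>,
    but neither \<open>m\<close> nor \<open>8 (a + p)\<close>.\<close>
  define m where "m = nat (\<Prod>M)"
  have pos: "0 \<le> l" if "l \<in> M" for l using that by (auto simp: M_def prime_factors_dvd prime_ge_0_int)
  then have m: "int m = \<Prod>M" by (simp add: m_def prod_nonneg)
  let ?b = "q + 4 * int m * d + 8 * (int m)\<^sup>2 * (a + p)"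
  have "\<not> l dvd ?b" if l: "prime l" "l dvd a" for l
  proof (cases "l dvd q")
    case False
    then have "l \<in> M" using l a by (auto simp: M_def prime_factors_dvd)
    then have "l dvd int m" unfolding m using fin by (rule dvd_prodI[rotated])
    then have "l dvd 4 * int m * d + 8 * (int m)\<^sup>2 * (a + p)" by (simp add: power2_eq_square)
    then show ?thesis using False by (simp add: add.assoc dvd_add_left_iff)
  next
    case True
    have odd_l: "l \<noteq> 2" using True l odd by auto
    have "d\<^sup>2 = 2 * (a * p + a * q + p * q)" using rel by (simp add: d_def)
    then have "l dvd d\<^sup>2" using True l by simp
    then have ld: "l dvd d" using l prime_dvd_power by blast
    have "\<not> l dvd p"
    proof
      assume "l dvd p"
      moreover have "h = d + a + p + q" by (simp add: d_def)
      ultimately show False using prim[of l] l True ld by simp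
    qed
    then have ap: "\<not> l dvd a + p" using l by (simp add: dvd_add_right_iff)
    have lm: "\<not> l dvd int m"
    proof
      assume "l dvd int m"
      then obtain r where r: "r \<in> M" "l dvd r" unfolding m using prime_dvd_prod_iff[OF fin, of l "\<lambda>x. x"] l by auto
      then have "prime r" by (auto simp: M_def)
      then have "l = r" using r l primes_dvd_imp_eq by blast
      then show False using r True by (simp add: M_def)
    qed
    have "\<not> l dvd 8"
    proof
      assume "l dvd 8"
      then have "l dvd 2 ^ 3" by simp
      then have "l dvd 2" using l prime_dvd_power by blast
      then show False using odd_l l primes_dvd_imp_eq[of l 2] by simp
    qed
    then have "\<not> l dvd 8 * (int m)\<^sup>2 * (a + p)"
      using ap lm l by (simp add: prime_dvd_mult_iff prime_dvd_power_iff)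
    then show ?thesis using True ld by (simp add: dvd_add_right_iff)
  qed
  then have no: "\<nexists>l. prime l \<and> l dvd gcd a ?b" by auto
  have "coprime a ?b"
  proof (rule ccontr)
    assume "\<not> coprime a ?b"
    then show False using no prime_divisor_exists[of "gcd a ?b"] a by (auto simp: is_unit_gcd)
  qed
  then show ?thesis unfolding d_def by blast
qed

text \<open>\<open>p\<close> and \<open>q\<close> are curvatures of tangent neighbours of a line,
  \<open>2 * h - p\<close> and \<open>2 * h - q\<close> those of the antipodal circles. The four
  bounds say that reflecting in a face at the line does not decrease the absolute value of the
  coordinate \<open>h\<close> of \<open>w\<close>.\<close>

lemma line_descent:
  fixes p q h :: int
  assumes rel: "(h - p - q)\<^sup>2 = 2 * (p * q)"
    and min: "\<bar>h\<bar> \<le> \<bar>2 * (p + q) - h\<bar>" "\<bar>h\<bar> \<le> \<bar>2 * (p + (2 * h - q)) - h\<bar>"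
      "\<bar>h\<bar> \<le> \<bar>2 * ((2 * h - p) + q) - h\<bar>" "\<bar>h\<bar> \<le> \<bar>2 * ((2 * h - p) + (2 * h - q)) - h\<bar>"
    and prim: "\<And>l. l dvd p \<Longrightarrow> l dvd q \<Longrightarrow> l dvd h \<Longrightarrow> l dvd 1"
  shows "\<bar>p\<bar> = 1 \<or> \<bar>q\<bar> = 1"
proof -
  define x y where "x = p - h" and "y = q - h"
  have pq: "p = h + x" "q = h + y" by (simp_all add: x_def y_def)
  \<comment> \<open>Together with the bound \<open>|x| + |y| \<le> |h|\<close> implied by minimality this forces \<open>x y = 0\<close>.\<close>
  have sq: "x\<^sup>2 + y\<^sup>2 = h\<^sup>2" using rel by (simp add: pq power2_eq_square algebra_simps)
  have "\<bar>x\<bar> + \<bar>y\<bar> \<le> \<bar>h\<bar>"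
  proof (rule ccontr)
    assume "\<not> ?thesis"
    then have t: "\<bar>h\<bar> < \<bar>x\<bar> + \<bar>y\<bar>" by simp
    \<comment> \<open>In \<open>x\<close> and \<open>y\<close> the bounds compare
      \<open>\<bar>h\<bar>\<close> with \<open>3 * h\<close> plus or minus \<open>2 * x\<close> plus
      or minus \<open>2 * y\<close>. The signs opposing \<open>h\<close> give
      \<open>3 * \<bar>h\<bar> - 2 * (\<bar>x\<bar> + \<bar>y\<bar>)\<close>, which must then be at
      most \<open>- \<bar>h\<bar>\<close>.\<close>
    have "2 * (\<bar>x\<bar> + \<bar>y\<bar>) \<ge> 4 * \<bar>h\<bar>"
      using min t unfolding pq by (smt (verit))
    then have "(2 * \<bar>h\<bar>)\<^sup>2 \<le> (\<bar>x\<bar> + \<bar>y\<bar>)\<^sup>2" by (intro power_mono) auto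
    also have "\<dots> \<le> 2 * (x\<^sup>2 + y\<^sup>2)" using zero_le_power2[of "\<bar>x\<bar> - \<bar>y\<bar>"] by (simp add: power2_sum power2_diff)
    finally have "h\<^sup>2 \<le> 0" unfolding sq by (simp add: power_mult_distrib)
    then have "h = 0" by simp
    then show False using t sq by (simp add: sum_power2_eq_zero_iff)
  qed
  then have "(\<bar>x\<bar> + \<bar>y\<bar>)\<^sup>2 \<le> \<bar>h\<bar>\<^sup>2" by (intro power_mono) auto
  then have "\<bar>x\<bar> * \<bar>y\<bar> \<le> 0" using sq by (simp add: power2_sum)
  then have "x = 0 \<or> y = 0" by (auto simp: mult_le_0_iff)
  then show ?thesis
  proof
    assume "x = 0"
    moreover from this have "y = h \<or> y = - h" using sq by (simp add: power2_eq_iff)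
    ultimately have "h dvd 1" using prim[of h] by (auto simp: pq)
    then show ?thesis using \<open>x = 0\<close> by (simp add: pq)
  next
    assume "y = 0"
    moreover from this have "x = h \<or> x = - h" using sq by (simp add: power2_eq_iff)
    ultimately have "h dvd 1" using prim[of h] by (auto simp: pq)
    then show ?thesis using \<open>y = 0\<close> by (simp add: pq)
  qed
qed

section \<open>Kronecker symbols with square and twice square moduli\<close>

lemma kronecker_prime_square:
  assumes "prime p" "\<not> p dvd m"
  shows "(kronecker_prime m p)\<^sup>2 = 1"
  using assms by (auto simp: kronecker_prime_def Legendre_def cong_0_iff)

lemma kronecker_eq_1I:
  assumes "n > 0" "\<And>p. prime p \<Longrightarrow> p dvd n \<Longrightarrow> kronecker_prime m p ^ multiplicity p n = 1"
  shows "kronecker m n = 1"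
  using assms by (simp add: kronecker_def kronecker_unit_def prime_factors_dvd)

lemma kronecker_square:
  fixes n :: int
  assumes "n \<noteq> 0" "coprime m n"
  shows "kronecker m (n\<^sup>2) = 1"
proof (rule kronecker_eq_1I)
  fix p :: int assume p: "prime p" "p dvd n\<^sup>2"
  then have "p dvd n" using prime_dvd_power by blast
  then have "\<not> p dvd m" using assms p not_coprimeI not_prime_unit by blast
  moreover have "multiplicity p (n\<^sup>2) = 2 * multiplicity p n"
    using p assms by (intro prime_elem_multiplicity_power_distrib) auto
  ultimately show "kronecker_prime m p ^ multiplicity p (n\<^sup>2) = 1"
    using kronecker_prime_square[OF p(1)] by (simp add: power_mult)
qed (use assms in simp)

text \<open>Only the prime 2 occurs to an odd power, and the residue condition on \<open>m\<close>
  makes its symbol 1.\<close>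

lemma kronecker_eight_square:
  fixes n :: int
  assumes "n \<noteq> 0" "coprime m n" "m mod 8 \<in> {1, 7}"
  shows "kronecker m (8 * n\<^sup>2) = 1"
proof (rule kronecker_eq_1I)
  fix p :: int assume p: "prime p" "p dvd 8 * n\<^sup>2"
  show "kronecker_prime m p ^ multiplicity p (8 * n\<^sup>2) = 1"
  proof (cases "p = 2")
    case True
    have "odd m" using assms(3) by (auto simp: even_iff_mod_2_eq_zero) presburger+
    then show ?thesis using assms by (simp add: kronecker_prime_def True)
  next
    case False
    have p8: "\<not> p dvd 8"
    proof
      assume "p dvd 8"
      then have "p dvd 2 ^ 3" by simp
      then have "p dvd 2" using p prime_dvd_power by blast
      then show False using False p primes_dvd_imp_eq[of p 2] by simp
    qed
    then have "p dvd n" using p prime_dvd_power prime_dvd_mult_iff by blast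
    then have "\<not> p dvd m" using assms p not_coprimeI not_prime_unit by blast
    moreover have "multiplicity p (8 * n\<^sup>2) = 2 * multiplicity p n"
      using p8 assms prime_imp_prime_elem[OF p(1)]
      by (simp add: prime_elem_multiplicity_mult_distrib prime_elem_multiplicity_power_distrib
          not_dvd_imp_multiplicity_0)
    ultimately show ?thesis
      using kronecker_prime_square[OF p(1)] by (simp add: power_mult)
  qed
qed (use assms in simp)

text \<open>The modulus in \<open>chi\<close> is a square, except for
  \<open>a = 2 * n\<^sup>2\<close> with \<open>n\<close> even. In that case 8 divides
  \<open>a\<close>, coprimality makes \<open>b\<close> odd, and the only odd residues allowed are 1
  and 7, for which the symbol at 2 is 1.\<close>

lemma chi_square_form:
  fixes a b n :: int
  assumes a: "a = n\<^sup>2 \<or> a = 2 * n\<^sup>2" "a \<noteq> 0" and co: "coprime a b"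
    and b: "(\<forall>k\<in>{a, b}. k mod 8 \<in> {0, 1, 2}) \<or> (\<forall>k\<in>{a, b}. k mod 8 \<in> {2, 4, 7})"
  shows "chi a b = 1"
proof -
  have n: "n \<noteq> 0" using a by auto
  have n2: "n\<^sup>2 mod 8 = (if even n then (if 4 dvd n then 0 else 4) else 1)"
  proof -
    have "n\<^sup>2 mod 8 = (n mod 8)\<^sup>2 mod 8" by (simp add: power_mod)
    moreover have "n mod 8 \<in> {0..<8}" by simp
    then have "n mod 8 \<in> {0,1,2,3,4,5,6,7}" by (simp add: atLeastLessThan_iff) presburger
    moreover have "even n \<longleftrightarrow> even (n mod 8)" "4 dvd n \<longleftrightarrow> 4 dvd (n mod 8)" by presburger+
    ultimately show ?thesis by auto
  qed
  have ab: "coprime (a + b) a" using co by (simp add: coprime_iff_gcd_eq_1 gcd.commute)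
  have cn: "coprime (a + b) n" using ab a(1) by auto
  then have cn': "coprime (- a - b) n" using coprime_minus_left_iff[of "a + b" n] by simp
  consider "a = n\<^sup>2" | "a = 2 * n\<^sup>2" "odd n" | "a = 2 * n\<^sup>2" "even n" using a by auto
  then show ?thesis
  proof cases
    case 1
    then have "a mod 8 \<noteq> 2" using n2 by auto
    then show ?thesis using kronecker_square[OF n cn] kronecker_square[OF n cn'] 1
      by (simp add: chi_def Let_def cong_def)
  next
    case 2
    then have "a mod 8 = 2" using n2 by presburger
    then show ?thesis using kronecker_square[OF n cn] 2 by (simp add: chi_def Let_def cong_def)
  next
    case 3
    then obtain m where m: "n = 2 * m" by blast
    then have a8: "a = 8 * m\<^sup>2" using 3 by (simp add: power2_eq_square)
    then have "odd b" using coprime_common_divisor[OF co, of 2] by auto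
    then have "b mod 8 \<noteq> 0" "b mod 8 \<noteq> 2" "b mod 8 \<noteq> 4" by presburger+
    then have "(a + b) mod 8 \<in> {1, 7}" using b a8 by auto
    then have "kronecker (a + b) (8 * m\<^sup>2) = 1"
      using n m cn by (intro kronecker_eight_square) auto
    then show ?thesis using a8 by (simp add: chi_def Let_def cong_def)
  qed
qed

section \<open>Neighbours of coprime curvature\<close>

lemma ex_less_3_avoiding: "\<exists>l<3. l \<noteq> x \<and> l \<noteq> (y :: nat)"
proof -
  have "0 \<noteq> x \<and> 0 \<noteq> y \<or> 1 \<noteq> x \<and> 1 \<noteq> y \<or> 2 \<noteq> x \<and> 2 \<noteq> y" by auto
  then show ?thesis
    by (elim disjE) (rule exI[of _ 0], simp, rule exI[of _ 1], simp, rule exI[of _ 2], simp)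
qed

context octahedron
begin

lemma realisesD:
  assumes "realises g L"
  shows "linear L" "mink (L x) (L y) = mink x y" "g ` locus x = locus (L x)"
  using assms unfolding realises_def by blast+

lemma packing_of_iff: "C \<in> packing_of S \<longleftrightarrow> (\<exists>g\<in>\<Gamma>. \<exists>i<6. C = g ` locus (v i))"
  unfolding packing_of_def S by auto

lemma frefl_realised:
  assumes "face i j k"
  obtains f where "f \<in> \<Gamma>" "realises f (frefl i j k)"
proof -
  obtain f where "f \<in> \<Gamma>" "\<And>x. f ` locus x = locus (frefl i j k x)" using frefl_in_group[OF assms] by metis
  then show ?thesis using that[of f] linear_frefl mink_frefl[OF assms] preserves_lattice_frefl[OF assms]
    unfolding realises_def by blast
qed

lemma face_012: "face 0 1 2"
  by (simp add: face_def)

lemma curvature_realised: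
  assumes "realises g L" "mink x x = 1"
  shows "\<bar>curvature P (g ` locus x)\<bar> = \<bar>fst (L x)\<bar>"
  using assms curvature_locus(1)[of "L x" P] by (simp add: realisesD)

text \<open>Every group element factors through \<open>g\<close>, so the lattice property, applied
  to the functional \<open>fst\<close> after \<open>L\<close>, spreads a common divisor of one
  configuration to all curvatures of the packing.\<close>

lemma configuration_divisor:
  assumes prim: "primitive_packing (packing_of S)"
    and g: "g \<in> \<Gamma>" "realises g L"
    and l: "\<And>i. i < 6 \<Longrightarrow> \<exists>c::int. fst (L (v i)) = of_int (l * c)"
  shows "l dvd 1"
proof -
  have "l dvd m" if m: "m \<in> int_curvatures (packing_of S)" for m
  proof -
    obtain C where C: "C \<in> packing_of S" "curvature (packing_of S) C = of_int m"
      using m unfolding int_curvatures_def by blast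
    then obtain h i where h: "h \<in> \<Gamma>" "i < 6" "curvature (packing_of S) (h ` locus (v i)) = of_int m"
      unfolding packing_of_iff by blast
    obtain g' where g': "g' \<in> \<Gamma>" "g \<circ> g' = id" using group_inverse[OF g(1)] by blast
    obtain M where M: "realises (g' \<circ> h) M" using group_realised group_comp g' h by blast
    have "realises h (L \<circ> M)"
      using realises_comp[OF g(2) M] g'(2) by (simp add: comp_assoc[symmetric])
    then have "\<bar>of_int m\<bar> = \<bar>fst (L (M (v i)))\<bar>"
      using curvature_realised[of h "L \<circ> M" "v i" "packing_of S"] h unit by simp
    moreover have "linear (\<lambda>x. fst (L x))"
      using linear_compose[OF realisesD(1)[OF g(2)] bounded_linear.linear[OF bounded_linear_fst]] by (simp add: o_def)
    then obtain c :: int where "fst (L (M (v i))) = of_int (l * c)"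
      using M l h(2) unfolding realises_def preserves_lattice_def by blast
    ultimately have "\<bar>m\<bar> = \<bar>l * c\<bar>" by linarith
    then show "l dvd m" by (metis dvd_abs_iff dvd_triv_left)
  qed
  then have "l dvd Gcd (int_curvatures (packing_of S))" by (rule Gcd_greatest)
  then show ?thesis using prim by (simp add: primitive_packing_def)
qed

text \<open>The integers \<open>k i\<close> are curvatures only up to sign, but as values of one
  linear functional they satisfy the linear and quadratic relations exactly.\<close>

definition integral_frame :: "(minkowski \<Rightarrow> minkowski) \<Rightarrow> (nat \<Rightarrow> int) \<Rightarrow> int \<Rightarrow> bool" where
  "integral_frame L k h \<longleftrightarrow>
     (\<forall>i<6. fst (L (v i)) = of_int (k i)) \<and> fst (L w) = of_int h \<and>
     (\<forall>i<6. k ((i + 3) mod 6) = 2 * h - k i) \<and>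
     (\<forall>i j l. face i j l \<longrightarrow> (k i - h)\<^sup>2 + (k j - h)\<^sup>2 + (k l - h)\<^sup>2 = 2 * h\<^sup>2) \<and>
     (\<forall>i j l d. face i j l \<longrightarrow> d dvd k i \<longrightarrow> d dvd k j \<longrightarrow> d dvd k l \<longrightarrow> d dvd h \<longrightarrow> d dvd 1) \<and>
     (\<forall>d. (\<forall>i<6. d dvd k i) \<longrightarrow> d dvd 1)"

lemma integral_frameD:
  assumes "integral_frame L k h"
  shows "i < 6 \<Longrightarrow> fst (L (v i)) = of_int (k i)" "fst (L w) = of_int h"
    "i < 6 \<Longrightarrow> k ((i + 3) mod 6) = 2 * h - k i"
    "face i j l \<Longrightarrow> (k i - h)\<^sup>2 + (k j - h)\<^sup>2 + (k l - h)\<^sup>2 = 2 * h\<^sup>2"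
    "face i j l \<Longrightarrow> d dvd k i \<Longrightarrow> d dvd k j \<Longrightarrow> d dvd k l \<Longrightarrow> d dvd h \<Longrightarrow> d dvd 1"
    "(\<And>i. i < 6 \<Longrightarrow> d dvd k i) \<Longrightarrow> d dvd 1"
  using assms unfolding integral_frame_def by blast+

lemma ex_integral_frame:
  assumes int: "integral_packing (packing_of S)" and prim: "primitive_packing (packing_of S)"
    and g: "g \<in> \<Gamma>" "realises g L"
  shows "\<exists>k h. integral_frame L k h"
proof -
  have "\<exists>c::int. fst (L (v i)) = of_int c" if "i < 6" for i
  proof -
    have "g ` locus (v i) \<in> packing_of S" using g that packing_of_iff by blast
    then have "curvature (packing_of S) (g ` locus (v i)) \<in> \<int>" using int unfolding integral_packing_def by blast
    then have "\<bar>fst (L (v i))\<bar> \<in> \<int>" using curvature_realised[OF g(2) unit[OF that], of "packing_of S"] Ints_abs by metis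
    then have "fst (L (v i)) \<in> \<int>" by (auto simp: abs_if minus_in_Ints_iff split: if_splits)
    then show ?thesis by (auto elim: Ints_cases)
  qed
  then obtain k :: "nat \<Rightarrow> int" where k: "\<And>i. i < 6 \<Longrightarrow> fst (L (v i)) = of_int (k i)" by metis
  have lin: "linear L" by (rule realisesD(1)[OF g(2)])
  have opp': "fst (L (v i)) + fst (L (v ((i + 3) mod 6))) = 2 * fst (L w)" if "i < 6" for i
    using arg_cong[OF opp[OF that], of "\<lambda>x. fst (L x)"] by (simp add: linear_add[OF lin] linear_scale[OF lin])
  have quad: "(fst (L (v i)) - fst (L w))\<^sup>2 + (fst (L (v j)) - fst (L w))\<^sup>2 + (fst (L (v l)) - fst (L w))\<^sup>2
    = 2 * (fst (L w))\<^sup>2" if "face i j l" for i j l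
    using curvature_quadric[OF that lin] realisesD(2)[OF g(2)] by blast
  \<comment> \<open>A priori only twice the coordinate of \<open>w\<close> is an integer. The
    quadratic relation shows that \<open>H\<^sup>2\<close> is a multiple of 4, so \<open>H\<close>
    is even.\<close>
  define H where "H = k 0 + k 3"
  have H: "2 * fst (L w) = of_int H" using opp'[of 0] k[of 0] k[of 3] by (simp add: H_def)
  have "(2 * of_int (k 0) - of_int H)\<^sup>2 + (2 * of_int (k 1) - of_int H)\<^sup>2 + (2 * of_int (k 2) - of_int H)\<^sup>2 = 2 * (of_int H :: real)\<^sup>2"
    using quad[OF face_012] unfolding H[symmetric]
    by (simp add: k power2_eq_square algebra_simps)
  then have "of_int ((2 * k 0 - H)\<^sup>2 + (2 * k 1 - H)\<^sup>2 + (2 * k 2 - H)\<^sup>2) = (of_int (2 * H\<^sup>2) :: real)" by simp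
  then have "(2 * k 0 - H)\<^sup>2 + (2 * k 1 - H)\<^sup>2 + (2 * k 2 - H)\<^sup>2 = 2 * H\<^sup>2" by (simp only: of_int_eq_iff)
  then have "H\<^sup>2 = 4 * (H * (k 0 + k 1 + k 2) - (k 0)\<^sup>2 - (k 1)\<^sup>2 - (k 2)\<^sup>2)"
    by (simp add: power2_eq_square algebra_simps)
  then have "even (H\<^sup>2)" by simp
  then have "even H" by simp
  then obtain h where h': "H = 2 * h" by blast
  then have h: "fst (L w) = of_int h" using H by simp
  have opph: "k ((i + 3) mod 6) = 2 * h - k i" if "i < 6" for i
  proof -
    have "of_int (k ((i + 3) mod 6)) = (of_int (2 * h - k i) :: real)"
      using opp'[OF that] k[of i] k[of "(i + 3) mod 6"] that by (simp add: h)
    then show ?thesis by (simp only: of_int_eq_iff)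
  qed
  have quadh: "(k i - h)\<^sup>2 + (k j - h)\<^sup>2 + (k l - h)\<^sup>2 = 2 * h\<^sup>2" if "face i j l" for i j l
  proof -
    have "of_int ((k i - h)\<^sup>2 + (k j - h)\<^sup>2 + (k l - h)\<^sup>2) = (of_int (2 * h\<^sup>2) :: real)"
      using quad[OF that] that k by (simp add: face_def h)
    then show ?thesis by (simp only: of_int_eq_iff)
  qed
  have all: "d dvd 1" if "\<forall>i<6. d dvd k i" for d
    using prim g
  proof (rule configuration_divisor)
    fix i :: nat assume "i < 6"
    then show "\<exists>c. fst (L (v i)) = real_of_int (d * c)" using k that by (metis dvdE)
  qed
  have "d dvd 1" if f: "face i j l" and d: "d dvd k i" "d dvd k j" "d dvd k l" "d dvd h" for i j l d
  proof (rule all, intro allI impI)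
    fix m :: nat assume "m < 6"
    from opposite_cases[OF f this] show "d dvd k m"
    proof
      assume "m \<in> {i, j, l}"
      then show ?thesis using d by auto
    next
      assume "\<exists>n\<in>{i, j, l}. m = (n + 3) mod 6"
      then obtain n where n: "n \<in> {i, j, l}" "m = (n + 3) mod 6" by blast
      then have "k m = 2 * h - k n" using opph[of n] f by (auto simp: face_def)
      then show ?thesis using n d by auto
    qed
  qed
  then have "integral_frame L k h" unfolding integral_frame_def using k h opph quadh all by blast
  then show ?thesis by blast
qed

lemma tangent_neighbour:
  assumes "g \<in> \<Gamma>" "i < 6" "j < 6" "i mod 3 \<noteq> j mod 3"
  shows "tangent (g ` locus (v i)) (g ` locus (v j))"
  using assms tangent by (intro tangent_image group_inj) auto

lemma coprime_neighbour:
  assumes int: "integral_packing (packing_of S)" and prim: "primitive_packing (packing_of S)"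
    and g: "g \<in> \<Gamma>" "realises g L" and i: "i < 6" and a: "fst (L (v i)) = of_int a" "a \<noteq> 0"
  shows "\<exists>C\<in>packing_of S. \<exists>b::int. tangent (g ` locus (v i)) C \<and> \<bar>curvature (packing_of S) C\<bar> = of_int \<bar>b\<bar> \<and> coprime a b"
proof -
  obtain k h where "integral_frame L k h" using ex_integral_frame[OF int prim g] by blast
  note k = integral_frameD[OF this]
  have ki: "k i = a" using k(1)[OF i] a by simp
  \<comment> \<open>Otherwise \<open>a\<close> and all neighbours are even, and so is the antipode,
    with value \<open>2 * h - a\<close>; all six being even contradicts primitivity.\<close>
  have "\<exists>l<6. i mod 3 \<noteq> l mod 3 \<and> (odd a \<or> odd (k l))"
  proof (rule ccontr)
    assume "\<not> ?thesis"
    then have no: "even a \<and> even (k l)" if "l < 6" "i mod 3 \<noteq> l mod 3" for l using that by blast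
    have "(i + 1) mod 6 mod 3 = (i + 1) mod 3" by (simp add: mod_mod_cancel)
    then have "(i + 1) mod 6 < 6" "i mod 3 \<noteq> (i + 1) mod 6 mod 3" by (auto simp: mod_Suc)
    then have ev: "even a" using no by blast
    have "even (k l)" if l: "l < 6" for l
    proof (cases "i mod 3 = l mod 3")
      case True
      then have "l = i \<or> l = (i + 3) mod 6" using eq_or_antipodal[OF l i] by simp
      then show ?thesis using ev ki k(3)[OF i] by auto
    qed (use no l in blast)
    then have "(2::int) dvd 1" by (rule k(6))
    then show False by simp
  qed
  then obtain l where l: "l < 6" "i mod 3 \<noteq> l mod 3" "odd a \<or> odd (k l)" by blast
  obtain j where "j < 3" "j \<noteq> i mod 3" "j \<noteq> l mod 3" using ex_less_3_avoiding by blast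
  then have f: "face i j l" using i l by (auto simp: face_def)
  then have j: "j < 6" by (simp add: face_def)
  have "(h - a - k j - k l)\<^sup>2 = 2 * (a * k j + a * k l + k j * k l)"
    using k(4)[OF f] by (simp add: ki power2_eq_square algebra_simps)
  then obtain m :: nat where m: "coprime a (k l + 4 * int m * (h - a - k j - k l) + 8 * (int m)\<^sup>2 * (a + k j))"
    using coprime_in_chain[of h a "k j" "k l"] k(5)[OF f] l(3) a(2) ki not_prime_unit by metis
  define x where "x = v l + (4 * real m) *\<^sub>R fvec i j l + (8 * (real m)\<^sup>2) *\<^sub>R (v i + v j)"
  obtain \<sigma> where \<sigma>: "\<sigma> \<in> \<Gamma>" "\<sigma> ` locus (v i) = locus (v i)" "\<sigma> ` locus (v l) = locus x"
    using chain[OF f, of m] unfolding x_def by blast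
  have gs: "g \<circ> \<sigma> \<in> \<Gamma>" using group_comp g \<sigma> by blast
  have lin: "linear L" by (rule realisesD(1)[OF g(2)])
  have "mink x x = 1"
  proof -
    have F: "mink (fvec i j l) (v m) = 0" "mink (v m) (fvec i j l) = 0" if "m \<in> {i, j, l}" for m
      using fvec_mink[OF f] that mink_commute[of "v m" "fvec i j l"] by auto
    show ?thesis
      using fvec_mink(5)[OF f] f unfolding x_def face_def
      by (simp add: mink_lin unit adj F) (simp add: algebra_simps power2_eq_square)
  qed
  then have "\<bar>curvature (packing_of S) ((g \<circ> \<sigma>) ` locus (v l))\<bar> = \<bar>fst (L x)\<bar>"
    using curvature_realised[OF g(2)] unfolding image_comp[symmetric] \<sigma> by blast
  also have "fst (L x) = of_int (k l + 4 * int m * (h - a - k j - k l) + 8 * (int m)\<^sup>2 * (a + k j))"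
    using k(1)[OF i] k(1)[OF j] k(1)[OF l(1)] k(2)
    by (simp add: x_def fvec_def linear_add[OF lin] linear_diff[OF lin] linear_scale[OF lin] ki algebra_simps)
  also have "\<bar>\<dots>\<bar> = of_int \<bar>k l + 4 * int m * (h - a - k j - k l) + 8 * (int m)\<^sup>2 * (a + k j)\<bar>" by simp
  finally have cur: "\<bar>curvature (packing_of S) ((g \<circ> \<sigma>) ` locus (v l))\<bar> = \<dots>" .
  have "(g \<circ> \<sigma>) ` locus (v i) = g ` locus (v i)" unfolding image_comp[symmetric] \<sigma> ..
  then have "tangent (g ` locus (v i)) ((g \<circ> \<sigma>) ` locus (v l))"
    using tangent_neighbour[OF gs i l(1,2)] by simp
  moreover have "(g \<circ> \<sigma>) ` locus (v l) \<in> packing_of S" using gs l packing_of_iff by blast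
  ultimately show ?thesis using cur m by blast
qed

lemma line_neighbour:
  assumes int: "integral_packing (packing_of S)" and prim: "primitive_packing (packing_of S)"
    and C: "g \<in> \<Gamma>" "i < 6" "C = g ` locus (v i)" "curvature (packing_of S) C = 0"
  shows "\<exists>C'\<in>packing_of S. tangent C C' \<and> \<bar>curvature (packing_of S) C'\<bar> = 1"
proof -
  \<comment> \<open>All ways to see \<open>C\<close> as the circle at the fixed vertex
    \<open>i\<close> of a configuration. The coordinate of \<open>w\<close> is then an integer, so
    \<open>nat\<close> and the floor in the minimisation lose nothing.\<close>
  define A where "A = {(g, L). g \<in> \<Gamma> \<and> realises g L \<and> C = g ` locus (v i)}"
  obtain L0 where "(g, L0) \<in> A" using group_realised C by (auto simp: A_def)
  then obtain gL where gL: "gL \<in> A" "\<And>y. y \<in> A \<Longrightarrow> nat \<lfloor>\<bar>fst (snd gL w)\<bar>\<rfloor> \<le> nat \<lfloor>\<bar>fst (snd y w)\<bar>\<rfloor>"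
    using ex_has_least_nat[of "\<lambda>x. x \<in> A" "(g, L0)" "\<lambda>gL. nat \<lfloor>\<bar>fst (snd gL w)\<bar>\<rfloor>"] by blast
  obtain G L where GL: "gL = (G, L)" by (cases gL)
  have G: "G \<in> \<Gamma>" "realises G L" "C = G ` locus (v i)" using gL(1) unfolding GL A_def by auto
  have min: "nat \<lfloor>\<bar>fst (L w)\<bar>\<rfloor> \<le> nat \<lfloor>\<bar>fst (M w)\<bar>\<rfloor>"
    if "f \<in> \<Gamma>" "realises f M" "C = f ` locus (v i)" for f M
    using gL(2)[of "(f, M)"] that by (simp add: GL A_def)
  obtain k h where "integral_frame L k h" using ex_integral_frame[OF int prim G(1,2)] by blast
  note k = integral_frameD[OF this]
  have ki: "k i = 0"
    using curvature_realised[OF G(2) unit[OF C(2)], of "packing_of S"] k(1)[OF C(2)] C(4) G(3) by simp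
  have lin: "linear L" by (rule realisesD(1)[OF G(2)])
  have desc: "\<bar>h\<bar> \<le> \<bar>2 * (k j + k l) - h\<bar>" if f: "face i j l" for j l
  proof -
    obtain \<sigma> where \<sigma>: "\<sigma> \<in> \<Gamma>" "realises \<sigma> (frefl i j l)" using frefl_realised[OF f] by blast
    have "\<sigma> ` locus (v i) = locus (v i)" using realisesD(3)[OF \<sigma>(2)] frefl_fix[OF f] by simp
    then have "C = (G \<circ> \<sigma>) ` locus (v i)" unfolding image_comp[symmetric] G(3) by simp
    then have "nat \<lfloor>\<bar>fst (L w)\<bar>\<rfloor> \<le> nat \<lfloor>\<bar>fst ((L \<circ> frefl i j l) w)\<bar>\<rfloor>"
      using min group_comp[OF G(1) \<sigma>(1)] realises_comp[OF G(2) \<sigma>(2)] by blast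
    \<comment> \<open>Since \<open>mink (fvec i j l) w = 2\<close> and \<open>k i = 0\<close>, the
      new value is \<open>h - 2 * (h - k j - k l)\<close>.\<close>
    moreover have "fst ((L \<circ> frefl i j l) w) = of_int (2 * (k j + k l) - h)"
      using k(1)[of i] k(1)[of j] k(1)[of l] k(2) f ki unfolding frefl_def o_apply fvec_mink(4)[OF f]
      by (simp add: fvec_def face_def linear_diff[OF lin] linear_scale[OF lin])
    ultimately have "nat \<bar>h\<bar> \<le> nat \<bar>2 * (k j + k l) - h\<bar>" unfolding k(2) by (simp only: floor_of_int flip: of_int_abs)
    then show ?thesis by simp
  qed
  obtain j where j: "j < 3" "j \<noteq> i mod 3" using ex_less_3_avoiding by blast
  obtain l where l: "l < 3" "l \<noteq> i mod 3" "l \<noteq> j" using ex_less_3_avoiding by blast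
  have f: "face i j l" "face i j (l + 3)" "face i (j + 3) l" "face i (j + 3) (l + 3)"
    using j l C(2) by (auto simp: face_def)
  have opp: "k (j + 3) = 2 * h - k j" "k (l + 3) = 2 * h - k l" using k(3)[of j] k(3)[of l] j l by simp_all
  have "(h - k j - k l)\<^sup>2 = 2 * (k j * k l)"
    using k(4)[OF f(1)] by (simp add: ki power2_eq_square algebra_simps)
  then have "\<bar>k j\<bar> = 1 \<or> \<bar>k l\<bar> = 1"
    using desc[OF f(1)] desc[OF f(2)] desc[OF f(3)] desc[OF f(4)] k(5)[OF f(1)] ki
    unfolding opp by (intro line_descent) auto
  moreover have "j < 6" "i mod 3 \<noteq> j mod 3" "l < 6" "i mod 3 \<noteq> l mod 3"
    using f(1) by (auto simp: face_def)
  ultimately obtain n where n: "n < 6" "i mod 3 \<noteq> n mod 3" "\<bar>k n\<bar> = 1" by blast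
  have "\<bar>curvature (packing_of S) (G ` locus (v n))\<bar> = 1"
    using curvature_realised[OF G(2) unit[OF n(1)]] k(1)[OF n(1)] n(3) by (metis of_int_1 of_int_abs)
  moreover have "tangent C (G ` locus (v n))" using tangent_neighbour[OF G(1) C(2) n(1,2)] G(3) by simp
  moreover have "G ` locus (v n) \<in> packing_of S" using G n packing_of_iff by blast
  ultimately show ?thesis by blast
qed

end

theorem theorem3p18:
  fixes P :: "eplane set set"
  assumes "octahedral_packing P"
    and "integral_packing P"
    and "primitive_packing P"
    and "(\<forall>k\<in>int_curvatures P. k mod 8 \<in> {0, 1, 2}) \<or>
         (\<forall>k\<in>int_curvatures P. k mod 8 \<in> {2, 4, 7})"
    and "\<And>C C' a b. C \<in> P \<Longrightarrow> C' \<in> P \<Longrightarrow> tangent C C' \<Longrightarrow>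
           curvature P C = of_int a \<Longrightarrow> curvature P C' = of_int b \<Longrightarrow>
           a \<noteq> 0 \<Longrightarrow> gcd a b = 1 \<Longrightarrow> chi a b = - 1"
  shows "\<not> (\<exists>C\<in>P. \<exists>n::int. curvature P C = of_int (n\<^sup>2) \<or> curvature P C = of_int (2 * n\<^sup>2))"
proof
  assume "\<exists>C\<in>P. \<exists>n::int. curvature P C = of_int (n\<^sup>2) \<or> curvature P C = of_int (2 * n\<^sup>2)"
  then obtain C n a where C: "C \<in> P" "curvature P C = of_int a" "a = n\<^sup>2 \<or> a = 2 * n\<^sup>2" by blast
  obtain S where conf: "octahedral_configuration S" "P = packing_of S"
    using assms(1) by (auto simp: octahedral_packing_def)
  obtain v w where "octahedron v w S" using octahedral_configuration_vec[OF conf(1)] by blast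
  then interpret octahedron v w S .
  obtain g i where g: "g \<in> \<Gamma>" "i < 6" "C = g ` locus (v i)" using C(1) unfolding conf(2) packing_of_iff by blast
  obtain L where L: "realises g L" using group_realised[OF g(1)] by blast
  have curL: "\<bar>of_int a\<bar> = \<bar>fst (L (v i))\<bar>" using curvature_realised[OF L unit[OF g(2)], of P] C(2) g(3) by simp
  show False
  proof (cases "a = 0")
    case False
    obtain a' :: int where a': "fst (L (v i)) = of_int a'" "\<bar>a'\<bar> = \<bar>a\<bar>"
    proof (cases "fst (L (v i)) = of_int a")
      case False
      then have "fst (L (v i)) = of_int (- a)" using curL by (auto simp: abs_if split: if_splits)
      then show ?thesis using that[of "- a"] by simp
    qed (use that[of a] in simp)
    then have "a' \<noteq> 0" using False by auto
    then obtain C' b where C': "C' \<in> P" "tangent C C'" "\<bar>curvature P C'\<bar> = of_int \<bar>b\<bar>" "coprime a' b"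
      using coprime_neighbour[OF assms(2,3)[unfolded conf(2)] g(1) L g(2) a'(1)] unfolding conf(2) g(3) by blast
    obtain b' :: int where b': "curvature P C' = of_int b'"
      using assms(2) C'(1) by (auto simp: integral_packing_def elim: Ints_cases)
    then have "\<bar>b'\<bar> = \<bar>b\<bar>" using C'(3) by linarith
    then have "coprime a b'" using C'(4) a'(2) by (metis coprime_abs_left_iff coprime_abs_right_iff)
    moreover have "a \<in> int_curvatures P" "b' \<in> int_curvatures P"
      using C C' b' unfolding int_curvatures_def by blast+
    ultimately have "chi a b' = 1" using assms(4) by (intro chi_square_form[OF C(3) False]) auto
    moreover have "chi a b' = -1"
      using assms(5)[OF C(1) C'(1,2) C(2) b' False] \<open>coprime a b'\<close> by (simp add: coprime_iff_gcd_eq_1)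
    ultimately show False by simp
  next
    case True
    then have "curvature (packing_of S) C = 0" using C(2) conf(2) by simp
    then obtain C' where C': "C' \<in> P" "tangent C C'" "\<bar>curvature P C'\<bar> = 1"
      using line_neighbour[OF assms(2,3)[unfolded conf(2)] g] unfolding conf(2) by blast
    obtain g' j where g': "g' \<in> \<Gamma>" "j < 6" "C' = g' ` locus (v j)" using C'(1) unfolding conf(2) packing_of_iff by blast
    obtain M where M: "realises g' M" using group_realised[OF g'(1)] by blast
    have C'M: "C' = locus (M (v j))" "mink (M (v j)) (M (v j)) = 1"
      using realisesD[OF M] g' unit by simp_all
    have "\<bar>fst (M (v j))\<bar> = 1" using curvature_locus(1)[OF C'M(2), of P] C' C'M(1) by simp
    then have "fst (M (v j)) \<noteq> 0" by auto
    moreover have "locus (L (v i)) \<in> P" "fst (L (v i)) = 0"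
      using C(1) curL True g(3) realisesD(3)[OF L] by simp_all
    \<comment> \<open>Curvature -1 would be compatible with the hypothesis, as
      \<open>kronecker (-1) (-1) = -1\<close>; the line \<open>C\<close> rules it out.\<close>
    ultimately have "curvature P C' > 0" using curvature_locus(2)[OF C'M(2)] C'M(1) by blast
    then have "curvature P C' = of_int 1" using C'(3) by simp
    \<comment> \<open>The pair is taken with \<open>C'\<close> first, because \<open>chi\<close> is
      prescribed only for a nonzero first curvature.\<close>
    then have "chi 1 0 = -1" using assms(5)[OF C'(1) C(1) tangent_sym[OF C'(2)] _ C(2)[unfolded True]] by simp
    moreover have "chi 1 0 = 1" by (rule chi_square_form[of _ 1]) auto
    ultimately show False by simp
  qed
qed

end
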